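(* Let $\kappa=\mathcal{O}(1)$ be a fixed constant and let $t=t(n)$ be arbitrary. The circuit complexity $\mathcal{C}(U_t)$ of any $(t,\kappa)$-doped Gaussian unitary $U_t$ on $n$ qubits satisfies, both in the qubit sense and in the fermionic sense, $$\mathcal{C}(U_t)=\begin{cases}\mathcal{O}(n^2+t^3), & \text{if }\kappa t\le n,\\ \mathcal{O}(n^2t), & \text{otherwise.}\end{cases}$$
   Context: On $n$ qubits with Pauli operators $X_k,Y_k,Z_k$, the Majorana operators are $\gamma_{2k-1}:=(\prod_{j=1}^{k-1}Z_j)X_k$ and $\gamma_{2k}:=(\prod_{j=1}^{k-1}Z_j)Y_k$, $k\in\{1,\dots,n\}$. A Gaussian unitary is a unitary $G$ for which there is $O\in\mathrm{O}(2n)$ with $G^\dagger\gamma_\mu G=\sum_{\nu}O_{\mu,\nu}\gamma_\nu$ for all $\mu$. A $\kappa$-local gate is a unitary generated by at most $\kappa$ distinct Majorana operators, i.e. of the form $e^{iH}$ with $H$ a Hermitian operator in the algebra generated by $\kappa$ fixed Majorana operators (possibly different ones for different gates). A $(t,\kappa)$-doped Gaussian unitary is a unitary $U_t=G_tW_t\cdots G_1W_1G_0$ with $G_0,\dots,G_t$ Gaussian unitaries and $W_1,\dots,W_t$ $\kappa$-local gates. The circuit complexity of a unitary is the minimum number of $\mathcal{O}(1)$-local gates needed to implement it. In the qubit sense, a gate is $\mathcal{O}(1)$-local if it acts non-trivially on $\mathcal{O}(1)$ qubits; in the fermionic sense, if it is generated by $\mathcal{O}(1)$ distinct Majorana operators.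 Constants in $\mathcal{O}(\cdot)$ may depend on $\kappa$ only. *)

theory Defs
  imports
    "Jordan_Normal_Form.Schur_Decomposition"
    "HOL-Library.Extended_Nat"
begin

text \<open>Operators on n qubits are complex matrices of dimension \<open>2 ^ n\<close>. Qubits are
  numbered from 1 to n and qubit 1 is the most significant bit of a basis index.\<close>

definition unitary_mat :: "nat \<Rightarrow> complex mat \<Rightarrow> bool" where
  "unitary_mat d U \<longleftrightarrow> U \<in> carrier_mat d d \<and> mat_adjoint U * U = 1\<^sub>m d \<and> U * mat_adjoint U = 1\<^sub>m d"

definition hermitian_mat :: "nat \<Rightarrow> complex mat \<Rightarrow> bool" where
  "hermitian_mat d H \<longleftrightarrow> H \<in> carrier_mat d d \<and> mat_adjoint H = H"

definition real_orthogonal_mat :: "nat \<Rightarrow> real mat \<Rightarrow> bool" where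
  "real_orthogonal_mat d Q \<longleftrightarrow> Q \<in> carrier_mat d d \<and> transpose_mat Q * Q = 1\<^sub>m d \<and> Q * transpose_mat Q = 1\<^sub>m d"

text \<open>The exponential series, summed entrywise; each of these series converges absolutely
  when A is square.\<close>

definition mat_exp :: "complex mat \<Rightarrow> complex mat" where
  "mat_exp A = mat (dim_row A) (dim_col A) (\<lambda>(i, j). \<Sum>k. (A ^\<^sub>m k) $$ (i, j) / fact k)"

definition mat_prod_list :: "nat \<Rightarrow> complex mat list \<Rightarrow> complex mat" where
  "mat_prod_list d As = foldr (*) As (1\<^sub>m d)"

definition kronecker :: "complex mat \<Rightarrow> complex mat \<Rightarrow> complex mat" where
  "kronecker A B = mat (dim_row A * dim_row B) (dim_col A * dim_col B)
     (\<lambda>(i, j). A $$ (i div dim_row B, j div dim_col B) * B $$ (i mod dim_row B, j mod dim_col B))"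

definition pauli_x :: "complex mat" where
  "pauli_x = mat_of_rows_list 2 [[0, 1], [1, 0]]"

definition pauli_y :: "complex mat" where
  "pauli_y = mat_of_rows_list 2 [[0, - \<i>], [\<i>, 0]]"

definition pauli_z :: "complex mat" where
  "pauli_z = mat_of_rows_list 2 [[1, 0], [0, - 1]]"

definition on_qubit :: "nat \<Rightarrow> nat \<Rightarrow> complex mat \<Rightarrow> complex mat" where
  "on_qubit n k P = kronecker (kronecker (1\<^sub>m (2 ^ (k - 1))) P) (1\<^sub>m (2 ^ (n - k)))"

text \<open>Meaningful for \<open>\<mu> \<in> {1..2 * n}\<close>; index \<open>2 * k - 1\<close> carries \<open>X\<close> and index
  \<open>2 * k\<close> carries \<open>Y\<close> on qubit k.\<close>

definition majorana :: "nat \<Rightarrow> nat \<Rightarrow> complex mat" where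
  "majorana n \<mu> = (let k = (\<mu> + 1) div 2 in
     mat_prod_list (2 ^ n) (map (\<lambda>j. on_qubit n j pauli_z) [1..<k]) *
     on_qubit n k (if odd \<mu> then pauli_x else pauli_y))"

definition gaussian_unitary :: "nat \<Rightarrow> complex mat \<Rightarrow> bool" where
  "gaussian_unitary n G \<longleftrightarrow> unitary_mat (2 ^ n) G \<and>
     (\<exists>Q. real_orthogonal_mat (2 * n) Q \<and>
        (\<forall>\<mu>\<in>{1..2 * n}. mat_adjoint G * majorana n \<mu> * G =
           mat (2 ^ n) (2 ^ n) (\<lambda>(i, j). \<Sum>\<nu>=1..2 * n.
             complex_of_real (Q $$ (\<mu> - 1, \<nu> - 1)) * majorana n \<nu> $$ (i, j))))"

inductive_set generated_algebra :: "nat \<Rightarrow> complex mat set \<Rightarrow> complex mat set"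
  for d :: nat and S :: "complex mat set" where
  gen: "A \<in> S \<Longrightarrow> A \<in> generated_algebra d S"
| one: "1\<^sub>m d \<in> generated_algebra d S"
| add: "A \<in> generated_algebra d S \<Longrightarrow> B \<in> generated_algebra d S \<Longrightarrow> A + B \<in> generated_algebra d S"
| mult: "A \<in> generated_algebra d S \<Longrightarrow> B \<in> generated_algebra d S \<Longrightarrow> A * B \<in> generated_algebra d S"
| smult: "A \<in> generated_algebra d S \<Longrightarrow> c \<cdot>\<^sub>m A \<in> generated_algebra d S"

definition majorana_local_gate :: "nat \<Rightarrow> nat \<Rightarrow> complex mat \<Rightarrow> bool" where
  "majorana_local_gate n l W \<longleftrightarrow>
     (\<exists>M H. M \<subseteq> {1..2 * n} \<and> card M \<le> l \<and> hermitian_mat (2 ^ n) H \<and>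
        H \<in> generated_algebra (2 ^ n) (majorana n ` M) \<and> W = mat_exp (\<i> \<cdot>\<^sub>m H))"

primrec alternating_product ::
    "(nat \<Rightarrow> complex mat) \<Rightarrow> (nat \<Rightarrow> complex mat) \<Rightarrow> nat \<Rightarrow> complex mat" where
  "alternating_product G W 0 = G 0"
| "alternating_product G W (Suc t) = G (Suc t) * W (Suc t) * alternating_product G W t"

definition doped_gaussian_unitary :: "nat \<Rightarrow> nat \<Rightarrow> nat \<Rightarrow> complex mat \<Rightarrow> bool" where
  "doped_gaussian_unitary n t \<kappa> U \<longleftrightarrow>
     (\<exists>G W. (\<forall>i\<in>{0..t}. gaussian_unitary n (G i)) \<and>
        (\<forall>i\<in>{1..t}. majorana_local_gate n \<kappa> (W i)) \<and> U = alternating_product G W t)"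

definition qubit_bit :: "nat \<Rightarrow> nat \<Rightarrow> nat \<Rightarrow> nat" where
  "qubit_bit n i k = i div 2 ^ (n - k) mod 2"

definition sub_index :: "nat \<Rightarrow> nat list \<Rightarrow> nat \<Rightarrow> nat" where
  "sub_index n qs i = (\<Sum>r<length qs. qubit_bit n i (qs ! r) * 2 ^ (length qs - 1 - r))"

text \<open>The operator acting as u on the (not necessarily adjacent) qubits listed in qs, in
  that order, and as the identity on all other qubits.\<close>

definition on_qubits :: "nat \<Rightarrow> nat list \<Rightarrow> complex mat \<Rightarrow> complex mat" where
  "on_qubits n qs u = mat (2 ^ n) (2 ^ n) (\<lambda>(i, j).
     if \<forall>k\<in>{1..n} - set qs. qubit_bit n i k = qubit_bit n j k
     then u $$ (sub_index n qs i, sub_index n qs j) else 0)"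

definition qubit_local_gate :: "nat \<Rightarrow> nat \<Rightarrow> complex mat \<Rightarrow> bool" where
  "qubit_local_gate n l W \<longleftrightarrow>
     (\<exists>qs u. distinct qs \<and> set qs \<subseteq> {1..n} \<and> length qs \<le> l \<and>
        unitary_mat (2 ^ length qs) u \<and> W = on_qubits n qs u)"

text \<open>The infimum is \<open>\<infinity>\<close> if no finite circuit implements U. Circuits have to implement U
  exactly, global phase included.\<close>

definition circuit_complexity :: "(complex mat \<Rightarrow> bool) \<Rightarrow> nat \<Rightarrow> complex mat \<Rightarrow> enat" where
  "circuit_complexity gate n U =
     (INF gs\<in>{gs. (\<forall>g\<in>set gs. gate g) \<and> mat_prod_list (2 ^ n) gs = U}. enat (length gs))"

definition qubit_circuit_complexity :: "nat \<Rightarrow> nat \<Rightarrow> complex mat \<Rightarrow> enat" where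
  "qubit_circuit_complexity l n = circuit_complexity (qubit_local_gate n l) n"

definition fermionic_circuit_complexity :: "nat \<Rightarrow> nat \<Rightarrow> complex mat \<Rightarrow> enat" where
  "fermionic_circuit_complexity l n = circuit_complexity (majorana_local_gate n l) n"

end

theory Submission
  imports Defs
begin

text \<open>Moving every Gaussian factor to the left turns U into a single Gaussian unitary times t conjugated gates
  \<open>F\<^bsup>\<dagger>\<^esup> W F\<close>. Conjugation by F sends the at most \<open>\<kappa>\<close> Majorana operators of W to real combinations
  of Majorana operators; a QR elimination by at most \<open>2 \<kappa> n\<close> rotations in adjacent planes \<open>(\<gamma>\<^sub>a, \<gamma>\<^sub>a\<^sub>+\<^sub>1)\<close>
  brings these back, up to sign, to the first few \<open>\<gamma>\<^sub>j\<close>. So each conjugated gate costs \<open>O(\<kappa> n)\<close>, the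
  Gaussian unitary costs \<open>O(n\<^sup>2)\<close> by the same elimination, and the total \<open>O(n\<^sup>2 + \<kappa> n t)\<close> is within both
  claimed bounds. No Jordan--Wigner strings occur, because the product of two adjacent Majorana operators
  acts on at most two qubits and the algebra of the first \<open>2 m\<close> of them acts on the first m qubits. Hence
  one and the same circuit is local in the qubit and in the fermionic sense.\<close>

subsection \<open>Adjoints, unitaries and the matrix exponential\<close>

text \<open>Rotations have determinant one, so eliminating all \<open>2 * n\<close> images of a
  Gaussian unitary can leave the last one with the wrong sign. An odd product of Majorana operators
  repairs it, and that product is itself assembled from local gates. What then remains commutes with
  every Majorana operator; these generate the full matrix algebra, so it is a scalar, and since the
  global phase counts, the scalar is paid for as one more gate. For a doping gate neither correction
  arises: \<open>\<gamma>\<^sub>j\<close> and \<open>- \<gamma>\<^sub>j\<close> generate the same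
  algebra, and undoing the elimination recovers the conjugated gate exactly. Hence
  \<open>4 * \<kappa> * n + 1\<close>: at most \<open>2 * \<kappa> * n\<close> rotations, one core
  gate, and the inverse rotations. The first indices are the target because the string of
  \<open>\<gamma>\<^sub>j\<close> reaches back to qubit 1, so that an initial block of Majorana
  operators lives on an initial block of qubits. Locality \<open>\<kappa> + 2\<close> leaves room
  for both kinds of gates: rotations involve two Majorana operators, core gates at most
  \<open>\<kappa>\<close>.\<close>

lemma mat_adjoint_dim [simp]:
  fixes A :: "complex mat"
  shows "dim_row (mat_adjoint A) = dim_col A" "dim_col (mat_adjoint A) = dim_row A"
  unfolding mat_adjoint_def by auto

lemma mat_adjoint_entry [simp]:
  fixes A :: "complex mat"
  assumes "i < dim_col A" "j < dim_row A"
  shows "mat_adjoint A $$ (i, j) = cnj (A $$ (j, i))"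
  using assms unfolding mat_adjoint_def
  by (simp add: mat_of_rows_index conjugate_complex_def)

lemma mat_adjoint_carrier [simp]:
  fixes A :: "complex mat"
  assumes "A \<in> carrier_mat m k"
  shows "mat_adjoint A \<in> carrier_mat k m"
  using assms by (intro carrier_matI) auto

lemma mat_adjoint_adjoint [simp]:
  fixes A :: "complex mat"
  shows "mat_adjoint (mat_adjoint A) = A"
  by (rule eq_matI) auto

lemma square_mult_carrier [simp]:
  assumes "A \<in> carrier_mat d d" "B \<in> carrier_mat d d"
  shows "A * B \<in> carrier_mat d d"
  using assms by (rule mult_carrier_mat)

lemma smult_smult_mat:
  fixes A :: "'a :: semigroup_mult mat"
  shows "a \<cdot>\<^sub>m (b \<cdot>\<^sub>m A) = (a * b) \<cdot>\<^sub>m A"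
  by (rule eq_matI) (auto simp: mult.assoc)

lemma mult_mat_entry:
  fixes A :: "'a :: comm_semiring_0 mat"
  assumes "A \<in> carrier_mat d d" "B \<in> carrier_mat d d" "i < d" "j < d"
  shows "(A * B) $$ (i, j) = (\<Sum>l<d. A $$ (i, l) * B $$ (l, j))"
  using assms by (auto simp: scalar_prod_def atLeast0LessThan intro!: sum.cong)

lemma square_mat_eqI:
  assumes "A \<in> carrier_mat d d" "B \<in> carrier_mat d d"
    and "\<And>i j. i < d \<Longrightarrow> j < d \<Longrightarrow> A $$ (i, j) = B $$ (i, j)"
  shows "A = B"
  using assms by (intro eq_matI) auto

lemma mat_adjoint_mult:
  fixes A :: "complex mat"
  assumes "A \<in> carrier_mat d d" "B \<in> carrier_mat d d"
  shows "mat_adjoint (A * B) = mat_adjoint B * mat_adjoint A"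
  by (rule eq_matI) (use assms in \<open>auto simp: scalar_prod_def mult.commute intro!: sum.cong\<close>)

lemma mat_adjoint_smult:
  fixes A :: "complex mat"
  shows "mat_adjoint (c \<cdot>\<^sub>m A) = cnj c \<cdot>\<^sub>m mat_adjoint A"
  by (rule eq_matI) auto

lemma mat_adjoint_one [simp]: "mat_adjoint (1\<^sub>m d :: complex mat) = 1\<^sub>m d"
  by (rule eq_matI) auto

lemma unitary_matD:
  assumes "unitary_mat d U"
  shows "U \<in> carrier_mat d d" "mat_adjoint U \<in> carrier_mat d d"
    "mat_adjoint U * U = 1\<^sub>m d" "U * mat_adjoint U = 1\<^sub>m d"
  using assms unfolding unitary_mat_def by auto

lemma unitary_mat_mult:
  assumes U: "unitary_mat d U" and V: "unitary_mat d V"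
  shows "unitary_mat d (U * V)"
proof -
  note u = unitary_matD[OF U] and v = unitary_matD[OF V]
  have "mat_adjoint V * mat_adjoint U * (U * V) = mat_adjoint V * ((mat_adjoint U * U) * V)"
    using u(1,2) v(1,2) by (simp add: assoc_mult_mat[of _ d d _ d _ d])
  moreover have "U * V * (mat_adjoint V * mat_adjoint U) = U * ((V * mat_adjoint V) * mat_adjoint U)"
    using u(1,2) v(1,2) by (simp add: assoc_mult_mat[of _ d d _ d _ d])
  ultimately show ?thesis
    using u v unfolding unitary_mat_def by (simp add: mat_adjoint_mult[of _ d])
qed

lemma unitary_mat_one [simp]: "unitary_mat d (1\<^sub>m d)"
  unfolding unitary_mat_def by simp

section \<open>Matrix powers and the entrywise exponential series\<close>

lemma pow_mat_add:
  assumes A: "A \<in> carrier_mat d d"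
  shows "A ^\<^sub>m k * A ^\<^sub>m m = A ^\<^sub>m (k + m)"
proof (induction m)
  case (Suc m)
  have "A ^\<^sub>m k * A ^\<^sub>m Suc m = A ^\<^sub>m k * A ^\<^sub>m m * A"
    using A by (simp add: assoc_mult_mat[of _ d d _ d _ d])
  then show ?case using Suc by simp
qed (use A in auto)

lemma pow_mat_smult:
  fixes c :: "'a :: comm_semiring_1"
  assumes A: "A \<in> carrier_mat d d"
  shows "(c \<cdot>\<^sub>m A) ^\<^sub>m k = c ^ k \<cdot>\<^sub>m A ^\<^sub>m k"
proof (induction k)
  case (Suc k)
  then show ?case using A
    by (simp add: mult_smult_distrib[of _ d d _ d] mult_smult_assoc_mat[of _ d d _ d] mult.commute)
       (simp add: smult_smult_mat mult.commute)
qed (use A in \<open>auto intro!: eq_matI\<close>)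

lemma mat_adjoint_pow:
  fixes A :: "complex mat"
  assumes A: "A \<in> carrier_mat d d"
  shows "mat_adjoint (A ^\<^sub>m k) = mat_adjoint A ^\<^sub>m k"
proof (induction k)
  case (Suc k)
  have "mat_adjoint A * mat_adjoint A ^\<^sub>m k = mat_adjoint A ^\<^sub>m k * mat_adjoint A"
    using pow_mat_add[of "mat_adjoint A" d 1 k] mat_adjoint_carrier[OF A] by simp
  then show ?case using Suc A by (simp add: mat_adjoint_mult[of _ d])
qed (use A mat_adjoint_carrier[OF A] in auto)

text \<open>Each further factor sums d products, so it costs at most a factor \<open>d * a\<close>.
  This crude geometric bound already makes every entry of the exponential series absolutely
  convergent.\<close>

lemma pow_mat_entry_bound:
  fixes A :: "complex mat"
  assumes A: "A \<in> carrier_mat d d" and a: "\<And>i j. i < d \<Longrightarrow> j < d \<Longrightarrow> norm (A $$ (i, j)) \<le> a"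
    and ij: "i < d" "j < d"
  shows "norm ((A ^\<^sub>m k) $$ (i, j)) \<le> (real d * a) ^ k"
  using ij
proof (induction k arbitrary: i j)
  case 0
  then show ?case using A by simp
next
  case (Suc k)
  have a0: "0 \<le> a" using a[OF Suc.prems] norm_ge_zero order_trans by blast
  have "norm ((A ^\<^sub>m Suc k) $$ (i, j)) = norm (\<Sum>l<d. (A ^\<^sub>m k) $$ (i, l) * A $$ (l, j))"
    using A Suc.prems by (simp add: mult_mat_entry[of _ d] del: index_mult_mat)
  also have "\<dots> \<le> (\<Sum>l<d. (real d * a) ^ k * a)"
    using Suc a a0 by (intro sum_norm_le) (auto simp: norm_mult intro!: mult_mono)
  also have "\<dots> = (real d * a) ^ Suc k" by (simp add: mult_ac)
  finally show ?case .
qed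

lemma mat_exp_summable:
  fixes A :: "complex mat"
  assumes A: "A \<in> carrier_mat d d" and ij: "i < d" "j < d"
  shows "summable (\<lambda>k. norm ((A ^\<^sub>m k) $$ (i, j) / fact k))"
proof -
  define a where "a = Max ((\<lambda>(i, j). norm (A $$ (i, j))) ` ({..<d} \<times> {..<d}))"
  have a: "norm (A $$ (i, j)) \<le> a" if "i < d" "j < d" for i j
    unfolding a_def using that by (intro Max_ge) (auto intro!: rev_image_eqI[of "(i, j)"])
  show ?thesis
  proof (rule summable_comparison_test[OF _ summable_exp[of "real d * a"]], intro exI allI impI)
    fix k
    show "norm (norm ((A ^\<^sub>m k) $$ (i, j) / fact k)) \<le> inverse (fact k) * (real d * a) ^ k"
      using pow_mat_entry_bound[OF A a ij, of k]
      by (simp add: norm_divide field_simps)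
  qed
qed

lemma mat_exp_carrier [simp]: "A \<in> carrier_mat d d \<Longrightarrow> mat_exp A \<in> carrier_mat d d"
  unfolding mat_exp_def by auto

lemma mat_exp_sums:
  fixes A :: "complex mat"
  assumes A: "A \<in> carrier_mat d d" and ij: "i < d" "j < d"
  shows "(\<lambda>k. (A ^\<^sub>m k) $$ (i, j) / fact k) sums (mat_exp A $$ (i, j))"
  using summable_norm_cancel[OF mat_exp_summable[OF assms]] A ij unfolding mat_exp_def
  by (auto intro: summable_sums)

lemma mat_expI:
  assumes "A \<in> carrier_mat d d" "B \<in> carrier_mat d d"
    and "\<And>i j. i < d \<Longrightarrow> j < d \<Longrightarrow> (\<lambda>k. (A ^\<^sub>m k) $$ (i, j) / fact k) sums (B $$ (i, j))"
  shows "mat_exp A = B"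
  using assms by (intro square_mat_eqI[of _ d]) (auto intro: sums_unique2[OF mat_exp_sums])

text \<open>The coefficient of degree p in \<open>exp x * exp (- x)\<close>; multiplied by
  \<open>fact p\<close> it is the binomial expansion of \<open>(1 - 1) ^ p\<close>.\<close>

lemma alternating_fact_sum:
  "(\<Sum>k\<le>p. (-1) ^ (p - k) / (fact k * fact (p - k))) = (if p = 0 then 1 else (0 :: complex))"
proof -
  have "(\<Sum>k\<le>p. (-1) ^ (p - k) / (fact k * fact (p - k))) =
      (\<Sum>k\<le>p. of_nat (p choose k) * 1 ^ k * (-1) ^ (p - k)) / (fact p :: complex)"
    by (simp add: sum_divide_distrib binomial_fact)
  also have "\<dots> = (1 + (-1)) ^ p / fact p"
    by (simp only: binomial_ring)
  finally show ?thesis by simp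
qed

text \<open>The one case of the addition formula from which unitarity of gates follows. Absolute
  convergence of the entries allows a Cauchy product for each summand of the matrix product.\<close>

lemma mat_exp_mult_neg:
  fixes A :: "complex mat"
  assumes A: "A \<in> carrier_mat d d"
  shows "mat_exp A * mat_exp (- 1 \<cdot>\<^sub>m A) = 1\<^sub>m d"
proof (rule square_mat_eqI[of _ d])
  let ?B = "- 1 \<cdot>\<^sub>m A"
  have B: "?B \<in> carrier_mat d d" using A by simp
  show "mat_exp A * mat_exp ?B \<in> carrier_mat d d" using A B by simp
  show "1\<^sub>m d \<in> carrier_mat d d" by simp
  fix i j assume ij: "i < d" "j < d"
  let ?a = "\<lambda>l k. (A ^\<^sub>m k) $$ (i, l) / fact k" and ?b = "\<lambda>l k. (?B ^\<^sub>m k) $$ (l, j) / fact k"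
  have "(\<lambda>p. \<Sum>k\<le>p. ?a l k * ?b l (p - k)) sums (mat_exp A $$ (i, l) * mat_exp ?B $$ (l, j))"
    if l: "l < d" for l
    using Cauchy_product_sums[OF mat_exp_summable[OF A ij(1) l] mat_exp_summable[OF B l ij(2)]]
      mat_exp_sums[OF A ij(1) l, THEN sums_unique] mat_exp_sums[OF B l ij(2), THEN sums_unique]
    by simp
  then have "(\<lambda>p. \<Sum>l<d. \<Sum>k\<le>p. ?a l k * ?b l (p - k)) sums
      (\<Sum>l<d. mat_exp A $$ (i, l) * mat_exp ?B $$ (l, j))"
    by (intro sums_sum) auto
  also have "(\<Sum>l<d. mat_exp A $$ (i, l) * mat_exp ?B $$ (l, j)) = (mat_exp A * mat_exp ?B) $$ (i, j)"
    using A B ij by (simp add: mult_mat_entry[of _ d] del: index_mult_mat)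
  \<comment> \<open>After exchanging the sums, the inner sum over l is an entry of a product of
    powers, which is \<open>A ^\<^sub>m p\<close> for every k. Only the alternating sum of
    factorials still depends on k, and it vanishes unless p is 0.\<close>
  also have "(\<lambda>p. \<Sum>l<d. \<Sum>k\<le>p. ?a l k * ?b l (p - k)) = (\<lambda>p. if p = 0 then 1\<^sub>m d $$ (i, j) else 0)"
  proof
    fix p
    have "(\<Sum>l<d. \<Sum>k\<le>p. ?a l k * ?b l (p - k)) = (\<Sum>k\<le>p. \<Sum>l<d. ?a l k * ?b l (p - k))"
      by (rule sum.swap)
    also have "\<dots> = (\<Sum>k\<le>p. (A ^\<^sub>m p) $$ (i, j) * ((-1) ^ (p - k) / (fact k * fact (p - k))))"
    proof (rule sum.cong[OF refl])
      fix k assume k: "k \<in> {..p}"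
      have "(\<Sum>l<d. ?a l k * ?b l (p - k)) =
         (\<Sum>l<d. (A ^\<^sub>m k) $$ (i, l) * (A ^\<^sub>m (p - k)) $$ (l, j)) * ((-1) ^ (p - k) / (fact k * fact (p - k)))"
        using A ij by (simp add: pow_mat_smult[of _ d] sum_distrib_right sum_distrib_left sum_divide_distrib mult_ac)
      also have "(\<Sum>l<d. (A ^\<^sub>m k) $$ (i, l) * (A ^\<^sub>m (p - k)) $$ (l, j)) = (A ^\<^sub>m k * A ^\<^sub>m (p - k)) $$ (i, j)"
        using A ij by (simp add: mult_mat_entry[of _ d] del: index_mult_mat)
      also have "A ^\<^sub>m k * A ^\<^sub>m (p - k) = A ^\<^sub>m p" using k pow_mat_add[OF A, of k "p - k"] by simp
      finally show "(\<Sum>l<d. ?a l k * ?b l (p - k)) = (A ^\<^sub>m p) $$ (i, j) * ((-1) ^ (p - k) / (fact k * fact (p - k)))" .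
    qed
    also have "\<dots> = (A ^\<^sub>m p) $$ (i, j) * (if p = 0 then 1 else 0)"
      by (simp only: sum_distrib_left[symmetric] alternating_fact_sum)
    also have "\<dots> = (if p = 0 then 1\<^sub>m d $$ (i, j) else 0)" using A by auto
    finally show "(\<Sum>l<d. \<Sum>k\<le>p. ?a l k * ?b l (p - k)) = (if p = 0 then 1\<^sub>m d $$ (i, j) else 0)" .
  qed
  finally have "(\<lambda>p. if p = 0 then 1\<^sub>m d $$ (i, j) else 0) sums ((mat_exp A * mat_exp ?B) $$ (i, j))" .
  moreover have "(\<lambda>p. if p = 0 then 1\<^sub>m d $$ (i, j) else 0) sums (1\<^sub>m d $$ (i, j) :: complex)"
    using sums_single[of 0 "\<lambda>_. 1\<^sub>m d $$ (i, j) :: complex"] by simp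
  ultimately show "(mat_exp A * mat_exp ?B) $$ (i, j) = 1\<^sub>m d $$ (i, j)"
    by (rule sums_unique2)
qed

lemma mat_adjoint_exp:
  fixes A :: "complex mat"
  assumes A: "A \<in> carrier_mat d d"
  shows "mat_adjoint (mat_exp A) = mat_exp (mat_adjoint A)"
proof (rule mat_expI[of _ d, symmetric])
  fix i j assume ij: "i < d" "j < d"
  have "(\<lambda>k. cnj ((A ^\<^sub>m k) $$ (j, i) / fact k)) sums cnj (mat_exp A $$ (j, i))"
    using mat_exp_sums[OF A ij(2,1)] by (simp only: sums_cnj)
  then show "(\<lambda>k. (mat_adjoint A ^\<^sub>m k) $$ (i, j) / fact k) sums mat_adjoint (mat_exp A) $$ (i, j)"
    using A ij mat_exp_carrier[OF A]
    by (simp add: mat_adjoint_pow[OF A, symmetric] del: mat_exp_carrier)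
qed (use A in auto)

lemma mat_adjoint_exp_hermitian:
  assumes H: "hermitian_mat d H"
  shows "mat_adjoint (mat_exp (\<i> \<cdot>\<^sub>m H)) = mat_exp (\<i> \<cdot>\<^sub>m (- 1 \<cdot>\<^sub>m H))"
  using H unfolding hermitian_mat_def
  by (subst mat_adjoint_exp[of _ d]) (auto simp: mat_adjoint_smult smult_smult_mat)

lemma unitary_mat_exp:
  assumes H: "hermitian_mat d H"
  shows "unitary_mat d (mat_exp (\<i> \<cdot>\<^sub>m H))"
proof -
  have h: "H \<in> carrier_mat d d" using H unfolding hermitian_mat_def by auto
  have 1: "mat_exp (\<i> \<cdot>\<^sub>m H) * mat_exp (\<i> \<cdot>\<^sub>m (- 1 \<cdot>\<^sub>m H)) = 1\<^sub>m d"
    using mat_exp_mult_neg[of "\<i> \<cdot>\<^sub>m H" d] h by (simp add: smult_smult_mat)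
  have 2: "mat_exp (\<i> \<cdot>\<^sub>m (- 1 \<cdot>\<^sub>m H)) * mat_exp (\<i> \<cdot>\<^sub>m H) = 1\<^sub>m d"
    using mat_exp_mult_neg[of "\<i> \<cdot>\<^sub>m (- 1 \<cdot>\<^sub>m H)" d] h by (simp add: smult_smult_mat)
  show ?thesis unfolding unitary_mat_def mat_adjoint_exp_hermitian[OF H] using 1 2 h by auto
qed

lemma conj_mat_entry:
  fixes A :: "'a :: comm_semiring_0 mat"
  assumes "A \<in> carrier_mat d d" "V \<in> carrier_mat d d" "U \<in> carrier_mat d d" "i < d" "j < d"
  shows "(V * A * U) $$ (i, j) = (\<Sum>m<d. \<Sum>l<d. V $$ (i, l) * A $$ (l, m) * U $$ (m, j))"
proof -
  have "(V * A * U) $$ (i, j) = (\<Sum>m<d. (V * A) $$ (i, m) * U $$ (m, j))"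
    using assms by (intro mult_mat_entry) auto
  also have "\<dots> = (\<Sum>m<d. (\<Sum>l<d. V $$ (i, l) * A $$ (l, m)) * U $$ (m, j))"
    using assms by (intro sum.cong refl arg_cong2[of _ _ _ _ "(*)"] mult_mat_entry) auto
  finally show ?thesis by (simp add: sum_distrib_right)
qed

lemma pow_mat_conj:
  fixes A :: "'a :: comm_semiring_1 mat"
  assumes A: "A \<in> carrier_mat d d" "V \<in> carrier_mat d d" "U \<in> carrier_mat d d"
    and inv: "U * V = 1\<^sub>m d" "V * U = 1\<^sub>m d"
  shows "(V * A * U) ^\<^sub>m k = V * A ^\<^sub>m k * U"
proof (induction k)
  case 0
  then show ?case using assms by simp
next
  case (Suc k)
  have "V * A ^\<^sub>m k * U * (V * A * U) = V * A ^\<^sub>m k * (U * V) * A * U"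
    using A by (simp add: assoc_mult_mat[of _ d d _ d _ d])
  also have "\<dots> = V * A ^\<^sub>m Suc k * U"
    using A inv by (simp add: assoc_mult_mat[of _ d d _ d _ d])
  finally show ?case using Suc by simp
qed

text \<open>Inner factors \<open>U * V\<close> cancel in every power, so each partial sum is
  conjugated. Used twice: to carry gates through Gaussian unitaries, and to show that exponentials
  act on no more qubits than their exponent.\<close>

lemma mat_exp_conj:
  fixes A :: "complex mat"
  assumes A: "A \<in> carrier_mat d d" "V \<in> carrier_mat d d" "U \<in> carrier_mat d d"
    and inv: "U * V = 1\<^sub>m d" "V * U = 1\<^sub>m d"
  shows "mat_exp (V * A * U) = V * mat_exp A * U"
proof (rule mat_expI[of _ d])
  show "V * A * U \<in> carrier_mat d d" "V * mat_exp A * U \<in> carrier_mat d d"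
    using A mat_exp_carrier[OF A(1)] by (metis mult_carrier_mat)+
  fix i j assume ij: "i < d" "j < d"
  have "(\<lambda>k. \<Sum>m<d. \<Sum>l<d. V $$ (i, l) * ((A ^\<^sub>m k) $$ (l, m) / fact k) * U $$ (m, j)) sums
     (\<Sum>m<d. \<Sum>l<d. V $$ (i, l) * mat_exp A $$ (l, m) * U $$ (m, j))"
    by (intro sums_sum sums_mult sums_mult2 mat_exp_sums[OF A(1)]) auto
  moreover have "((V * A * U) ^\<^sub>m k) $$ (i, j) / fact k =
    (\<Sum>m<d. \<Sum>l<d. V $$ (i, l) * ((A ^\<^sub>m k) $$ (l, m) / fact k) * U $$ (m, j))" for k
    unfolding pow_mat_conj[OF assms] using conj_mat_entry[of "A ^\<^sub>m k" d V U i j] A ij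
    by (simp add: sum_divide_distrib)
  ultimately show "(\<lambda>k. ((V * A * U) ^\<^sub>m k) $$ (i, j) / fact k) sums (V * mat_exp A * U) $$ (i, j)"
    using conj_mat_entry[of "mat_exp A" d V U i j] A ij by simp
qed

text \<open>Euler's formula. It gives rotation gates, the gate proportional to a single Majorana
  operator, and global phases (with P the identity) in closed form.\<close>

lemma mat_exp_involution:
  fixes P :: "complex mat"
  assumes P: "P \<in> carrier_mat d d" and inv: "P * P = 1\<^sub>m d"
  shows "mat_exp (\<i> \<cdot>\<^sub>m (complex_of_real x \<cdot>\<^sub>m P)) = of_real (cos x) \<cdot>\<^sub>m 1\<^sub>m d + (\<i> * of_real (sin x)) \<cdot>\<^sub>m P"
proof (rule mat_expI[of _ d])
  have pow: "P ^\<^sub>m k = (if even k then 1\<^sub>m d else P)" for k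
    using P inv by (induction k) auto
  fix i j assume ij: "i < d" "j < d"
  let ?z = "\<i> * complex_of_real x" and ?e = "1\<^sub>m d $$ (i, j) :: complex" and ?p = "P $$ (i, j)"
  \<comment> \<open>\<open>(?e + ?p) / 2\<close> and \<open>(?e - ?p) / 2\<close> are entries of the
    projections onto the eigenspaces of P for 1 and -1. On them the series becomes the scalar series
    of \<open>exp ?z\<close> and \<open>exp (- ?z)\<close>.\<close>
  have "((\<i> \<cdot>\<^sub>m (complex_of_real x \<cdot>\<^sub>m P)) ^\<^sub>m k) $$ (i, j) / fact k =
      (?e + ?p) / 2 * (?z ^ k /\<^sub>R fact k) + (?e - ?p) / 2 * ((- ?z) ^ k /\<^sub>R fact k)" for k
  proof -
    have "((\<i> \<cdot>\<^sub>m (complex_of_real x \<cdot>\<^sub>m P)) ^\<^sub>m k) $$ (i, j) = ?z ^ k * (P ^\<^sub>m k) $$ (i, j)"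
      using P ij pow_mat_smult[of P d ?z k] by (simp add: smult_smult_mat)
    then show ?thesis unfolding pow using P ij
      by (auto simp: scaleR_conv_of_real field_simps power_minus_odd simp del: index_one_mat)
  qed
  moreover have "(\<lambda>k. (?e + ?p) / 2 * (?z ^ k /\<^sub>R fact k) + (?e - ?p) / 2 * ((- ?z) ^ k /\<^sub>R fact k)) sums
     ((?e + ?p) / 2 * exp ?z + (?e - ?p) / 2 * exp (- ?z))"
    by (intro sums_add sums_mult exp_converges)
  moreover have "(?e + ?p) / 2 * exp ?z + (?e - ?p) / 2 * exp (- ?z) = of_real (cos x) * ?e + (\<i> * of_real (sin x)) * ?p"
  proof -
    have "exp ?z = of_real (cos x) + \<i> * of_real (sin x)" "exp (- ?z) = of_real (cos x) - \<i> * of_real (sin x)"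
      using cis_conv_exp[of x] cis_conv_exp[of "-x"] by (auto simp: complex_eq_iff)
    then show ?thesis
      by (simp add: distrib_left distrib_right left_diff_distrib right_diff_distrib
          add_divide_distrib diff_divide_distrib del: index_one_mat)
  qed
  ultimately show "(\<lambda>k. ((\<i> \<cdot>\<^sub>m (complex_of_real x \<cdot>\<^sub>m P)) ^\<^sub>m k) $$ (i, j) / fact k) sums
     (of_real (cos x) \<cdot>\<^sub>m 1\<^sub>m d + (\<i> * of_real (sin x)) \<cdot>\<^sub>m P) $$ (i, j)"
    using P ij by simp
qed (use P in auto)

subsection \<open>Pauli strings and Majorana operators as monomial matrices\<close>

text \<open>Pauli strings permute the basis up to phases. In this encoding products compose index
  maps and multiply coefficients, so that operator identities become identities between signs under
  bit flips.\<close>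

definition monomial_mat :: "nat \<Rightarrow> (nat \<Rightarrow> nat) \<Rightarrow> (nat \<Rightarrow> complex) \<Rightarrow> complex mat" where
  "monomial_mat d f c = mat d d (\<lambda>(i, j). if j = f i then c i else 0)"

lemma monomial_mat_carrier [simp]: "monomial_mat d f c \<in> carrier_mat d d"
  unfolding monomial_mat_def by simp

lemma monomial_mat_cong:
  assumes "\<And>i. i < d \<Longrightarrow> f i = g i" "\<And>i. i < d \<Longrightarrow> c i = e i"
  shows "monomial_mat d f c = monomial_mat d g e"
  using assms unfolding monomial_mat_def by (intro cong_mat) auto

lemma monomial_mat_mult_left_entry:
  assumes "A \<in> carrier_mat d d" "\<And>i. i < d \<Longrightarrow> f i < d" "i < d" "j < d"
  shows "(monomial_mat d f c * A) $$ (i, j) = c i * A $$ (f i, j)"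
  using assms by (subst mult_mat_entry[of _ d]) (auto simp: monomial_mat_def if_distrib[of "\<lambda>x. x * _"] cong: if_cong)

text \<open>Involutivity of f turns the condition \<open>j = f l\<close> on the summation index into
  \<open>l = f j\<close>, leaving one summand.\<close>

lemma monomial_mat_mult_right_entry:
  assumes "A \<in> carrier_mat d d" "\<And>i. i < d \<Longrightarrow> f i < d" "\<And>i. f (f i) = i" "i < d" "j < d"
  shows "(A * monomial_mat d f c) $$ (i, j) = A $$ (i, f j) * c (f j)"
proof -
  have "j = f l \<longleftrightarrow> l = f j" for l using assms(3) by metis
  then have "(A * monomial_mat d f c) $$ (i, j) = (\<Sum>l<d. if l = f j then A $$ (i, l) * c l else 0)"
    using assms
    by (subst mult_mat_entry[of _ d])
       (simp_all add: monomial_mat_def if_distrib[of "\<lambda>x. _ * x"] cong: if_cong)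
  then show ?thesis using assms by simp
qed

lemma monomial_mat_mult:
  assumes "\<And>i. i < d \<Longrightarrow> f i < d"
  shows "monomial_mat d f c * monomial_mat d g e = monomial_mat d (\<lambda>i. g (f i)) (\<lambda>i. c i * e (f i))"
proof (rule square_mat_eqI[of _ d])
  fix i j assume ij: "i < d" "j < d"
  then have "(monomial_mat d f c * monomial_mat d g e) $$ (i, j) = c i * monomial_mat d g e $$ (f i, j)"
    by (intro monomial_mat_mult_left_entry assms) simp_all
  then show "(monomial_mat d f c * monomial_mat d g e) $$ (i, j) =
      monomial_mat d (\<lambda>i. g (f i)) (\<lambda>i. c i * e (f i)) $$ (i, j)"
    using ij assms[OF ij(1)] by (simp add: monomial_mat_def)
qed simp_all

lemma monomial_mat_smult: "a \<cdot>\<^sub>m monomial_mat d f c = monomial_mat d f (\<lambda>i. a * c i)"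
  unfolding monomial_mat_def by (rule eq_matI) auto

lemma monomial_mat_one: "monomial_mat d (\<lambda>i. i) (\<lambda>i. 1) = 1\<^sub>m d"
  unfolding monomial_mat_def by (rule eq_matI) auto

lemma monomial_mat_adjoint:
  assumes "\<And>i. f (f i) = i"
  shows "mat_adjoint (monomial_mat d f c) = monomial_mat d f (\<lambda>i. cnj (c (f i)))"
proof -
  have "i = f j \<longleftrightarrow> j = f i" for i j using assms by metis
  then show ?thesis unfolding monomial_mat_def by (intro eq_matI) (auto simp: assms)
qed

section \<open>Bits of basis indices and entries of one-qubit operators\<close>

lemma flip_bit_flip_bit [simp]: "flip_bit p (flip_bit p (i :: nat)) = i"
  by (rule bit_eqI) (auto simp: bit_simps)

lemma flip_bit_commute: "flip_bit p (flip_bit q (i :: nat)) = flip_bit q (flip_bit p i)"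
  by (rule bit_eqI) (auto simp: bit_simps)

lemma flip_bit_less:
  assumes "i < 2 ^ n" "p < n"
  shows "flip_bit p (i :: nat) < 2 ^ n"
  using assms by (metis take_bit_nat_eq_self_iff take_bit_flip_bit_eq not_le)

lemma nat_eq_bitsI:
  assumes "i < 2 ^ n" "j < 2 ^ n" "\<And>p. p < n \<Longrightarrow> bit i p = bit (j :: nat) p"
  shows "i = j"
proof -
  have "take_bit n i = take_bit n j"
    using assms(3) by (intro bit_eqI) (auto simp: bit_simps)
  then show ?thesis using assms(1,2) by (simp add: take_bit_nat_eq_self)
qed

lemma bit_flip_bit_nat: "bit (flip_bit p (i :: nat)) q \<longleftrightarrow> (if p = q then \<not> bit i q else bit i q)"
  by (auto simp: bit_simps)

lemma qubit_bit_eq: "qubit_bit n i k = of_bool (bit i (n - k))"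
  unfolding qubit_bit_def by (simp add: bit_iff_odd mod_2_eq_odd)

lemma on_qubit_carrier [simp]:
  assumes "k \<in> {1..n}" "P \<in> carrier_mat 2 2"
  shows "on_qubit n k P \<in> carrier_mat (2 ^ n) (2 ^ n)"
proof -
  have "2 ^ (k - 1) * 2 * 2 ^ (n - k) = (2 :: nat) ^ (k - 1 + 1 + (n - k))"
    by (simp only: power_add power_one_right)
  also have "\<dots> = 2 ^ n" using assms by simp
  finally show ?thesis using assms unfolding on_qubit_def kronecker_def by (intro carrier_matI) simp_all
qed

text \<open>Translates the index arithmetic of a Kronecker product into bits. Qubit k sits at bit
  position \<open>n - k\<close>; the higher bits index the identity on its left, the lower bits the
  one on its right.\<close>

lemma off_position_bits_eq_iff:
  fixes i j :: nat
  assumes "i < 2 ^ n" "j < 2 ^ n"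
  shows "i div 2 ^ p div 2 = j div 2 ^ p div 2 \<and> i mod 2 ^ p = j mod 2 ^ p \<longleftrightarrow>
    (\<forall>q<n. q \<noteq> p \<longrightarrow> bit i q = bit j q)" (is "?L \<longleftrightarrow> ?R")
proof
  assume ?L
  then have d: "drop_bit (Suc p) i = drop_bit (Suc p) j" and t: "take_bit p i = take_bit p j"
    by (simp_all only: drop_bit_eq_div take_bit_eq_mod power_Suc2 div_mult2_eq)
  show ?R
  proof (intro allI impI)
    fix q assume "q < n" "q \<noteq> p"
    then consider "q < p" | "Suc p \<le> q" by linarith
    then show "bit i q = bit j q"
    proof cases
      case 1
      then show ?thesis using arg_cong[OF t, of "\<lambda>x. bit x q"] by (simp add: bit_simps)
    next
      case 2
      then show ?thesis using arg_cong[OF d, of "\<lambda>x. bit x (q - Suc p)"] by (simp add: bit_simps)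
    qed
  qed
next
  assume R: ?R
  have high: "\<not> bit i q" "\<not> bit j q" if "q \<ge> n" for q
    using assms that by (metis bit_take_bit_iff not_le take_bit_nat_eq_self)+
  have eq: "bit i q = bit j q" if "q \<noteq> p" for q
    using R high that by (cases "q < n") auto
  have "drop_bit (Suc p) i = drop_bit (Suc p) j" "take_bit p i = take_bit p j"
    using eq by (auto intro!: bit_eqI simp: bit_simps)
  then show ?L
    by (simp only: drop_bit_eq_div take_bit_eq_mod power_Suc2 div_mult2_eq)
qed

lemma on_qubit_entry:
  assumes k: "k \<in> {1..n}" and P: "P \<in> carrier_mat 2 2" and ij: "i < 2 ^ n" "j < 2 ^ n"
  shows "on_qubit n k P $$ (i, j) =
    (if \<forall>q<n. q \<noteq> n - k \<longrightarrow> bit i q = bit j q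
     then P $$ (of_bool (bit i (n - k)), of_bool (bit j (n - k))) else 0)"
proof -
  let ?b = "2 ^ (n - k) :: nat"
  have pow: "2 ^ (k - 1) * 2 * ?b = (2 :: nat) ^ n"
  proof -
    have "2 ^ (k - 1) * 2 * ?b = (2 :: nat) ^ (k - 1 + 1 + (n - k))"
      by (simp only: power_add power_one_right)
    also have "\<dots> = 2 ^ n" using k by simp
    finally show ?thesis .
  qed
  have b: "x div ?b < 2 ^ (k - 1) * 2" "x div ?b div 2 < 2 ^ (k - 1)" if "x < 2 ^ n" for x
  proof -
    show "x div ?b < 2 ^ (k - 1) * 2" using that pow by (simp add: less_mult_imp_div_less)
    then show "x div ?b div 2 < 2 ^ (k - 1)" by (simp add: less_mult_imp_div_less)
  qed
  have "on_qubit n k P $$ (i, j) =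
    (if i div ?b div 2 = j div ?b div 2 then 1 else 0) * P $$ (i div ?b mod 2, j div ?b mod 2) *
    (if i mod ?b = j mod ?b then 1 else 0)"
    using b[OF ij(1)] b[OF ij(2)] P pow ij unfolding on_qubit_def kronecker_def
    by simp
  also have "\<dots> = (if \<forall>q<n. q \<noteq> n - k \<longrightarrow> bit i q = bit j q then P $$ (i div ?b mod 2, j div ?b mod 2) else 0)"
    using off_position_bits_eq_iff[OF ij, of "n - k"] by auto
  also have "(i div ?b mod 2, j div ?b mod 2) = (of_bool (bit i (n - k)), of_bool (bit j (n - k)))"
    by (simp add: bit_iff_odd mod_2_eq_odd)
  finally show ?thesis .
qed

section \<open>Pauli and Majorana operators in monomial form\<close>

definition z_sign :: "nat \<Rightarrow> nat \<Rightarrow> nat \<Rightarrow> complex" where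
  "z_sign n k i = (if bit i (n - k) then - 1 else 1)"

lemma pauli_carrier [simp]:
  "pauli_x \<in> carrier_mat 2 2" "pauli_y \<in> carrier_mat 2 2" "pauli_z \<in> carrier_mat 2 2"
  unfolding pauli_x_def pauli_y_def pauli_z_def mat_of_rows_list_def by (simp_all add: numeral_2_eq_2)

lemma pauli_entries:
  "pauli_x $$ (0, 0) = 0" "pauli_x $$ (0, Suc 0) = 1" "pauli_x $$ (Suc 0, 0) = 1" "pauli_x $$ (Suc 0, Suc 0) = 0"
  "pauli_y $$ (0, 0) = 0" "pauli_y $$ (0, Suc 0) = - \<i>" "pauli_y $$ (Suc 0, 0) = \<i>" "pauli_y $$ (Suc 0, Suc 0) = 0"
  "pauli_z $$ (0, 0) = 1" "pauli_z $$ (0, Suc 0) = 0" "pauli_z $$ (Suc 0, 0) = 0" "pauli_z $$ (Suc 0, Suc 0) = - 1"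
  unfolding pauli_x_def pauli_y_def pauli_z_def mat_of_rows_list_def by simp_all

lemma flip_bit_eq_iff:
  assumes "i < 2 ^ n" "j < 2 ^ n" "p < n"
  shows "j = flip_bit p (i :: nat) \<longleftrightarrow> (\<forall>q<n. q \<noteq> p \<longrightarrow> bit i q = bit j q) \<and> bit j p \<noteq> bit i p" (is "?L \<longleftrightarrow> ?R")
proof
  assume ?R
  then show ?L
    by (intro nat_eq_bitsI[OF assms(2) flip_bit_less[OF assms(1,3)]]) (auto simp: bit_flip_bit_nat)
qed (auto simp: bit_flip_bit_nat)

lemma on_qubit_pauli_monomial:
  assumes k: "k \<in> {1..n}"
  shows "on_qubit n k pauli_x = monomial_mat (2 ^ n) (flip_bit (n - k)) (\<lambda>_. 1)"
    and "on_qubit n k pauli_y = monomial_mat (2 ^ n) (flip_bit (n - k)) (\<lambda>i. if bit i (n - k) then \<i> else - \<i>)"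
    and "on_qubit n k pauli_z = monomial_mat (2 ^ n) (\<lambda>i. i) (z_sign n k)"
proof -
  have p: "n - k < n" using k by auto
  show "on_qubit n k pauli_x = monomial_mat (2 ^ n) (flip_bit (n - k)) (\<lambda>_. 1)"
    by (rule square_mat_eqI[of _ "2 ^ n"])
       (use k in \<open>auto simp: on_qubit_entry monomial_mat_def pauli_entries flip_bit_eq_iff[OF _ _ p]\<close>)
  show "on_qubit n k pauli_y = monomial_mat (2 ^ n) (flip_bit (n - k)) (\<lambda>i. if bit i (n - k) then \<i> else - \<i>)"
    by (rule square_mat_eqI[of _ "2 ^ n"])
       (use k in \<open>auto simp: on_qubit_entry monomial_mat_def pauli_entries flip_bit_eq_iff[OF _ _ p]\<close>)
  show "on_qubit n k pauli_z = monomial_mat (2 ^ n) (\<lambda>i. i) (z_sign n k)"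
  proof (rule square_mat_eqI[of _ "2 ^ n"])
    fix i j :: nat assume ij: "i < 2 ^ n" "j < 2 ^ n"
    have "j = i \<longleftrightarrow> (\<forall>q<n. q \<noteq> n - k \<longrightarrow> bit i q = bit j q) \<and> bit i (n - k) = bit j (n - k)"
      using nat_eq_bitsI[OF ij] by metis
    then show "on_qubit n k pauli_z $$ (i, j) = monomial_mat (2 ^ n) (\<lambda>i. i) (z_sign n k) $$ (i, j)"
      using k ij by (auto simp: on_qubit_entry monomial_mat_def pauli_entries z_sign_def)
  qed (use k in auto)
qed

text \<open>The eigenvalue of the Jordan-Wigner string on the qubits before k at the basis state
  i.\<close>

definition jw_sign :: "nat \<Rightarrow> nat \<Rightarrow> nat \<Rightarrow> complex" where
  "jw_sign n k i = (\<Prod>j\<in>{1..<k}. z_sign n j i)"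

text \<open>\<open>(\<mu> + 1) div 2\<close> is the qubit of the operator. For even
  \<open>\<mu>\<close> the last factor lists the two nonzero entries of Y by row:
  \<open>- \<i>\<close> in row 0 and \<open>\<i>\<close> in row 1.\<close>

definition majorana_coeff :: "nat \<Rightarrow> nat \<Rightarrow> nat \<Rightarrow> complex" where
  "majorana_coeff n \<mu> i = jw_sign n ((\<mu> + 1) div 2) i *
     (if odd \<mu> then 1 else if bit i (n - (\<mu> + 1) div 2) then \<i> else - \<i>)"

lemma z_string_monomial:
  assumes "set xs \<subseteq> {1..n}"
  shows "mat_prod_list (2 ^ n) (map (\<lambda>j. on_qubit n j pauli_z) xs) =
    monomial_mat (2 ^ n) (\<lambda>i. i) (\<lambda>i. \<Prod>j\<leftarrow>xs. z_sign n j i)"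
  using assms
  by (induction xs)
     (auto simp: mat_prod_list_def monomial_mat_one on_qubit_pauli_monomial monomial_mat_mult)

lemma z_string_upt_monomial:
  assumes "k \<le> n"
  shows "mat_prod_list (2 ^ n) (map (\<lambda>j. on_qubit n j pauli_z) [1..<k]) =
    monomial_mat (2 ^ n) (\<lambda>i. i) (jw_sign n k)"
proof -
  have "(\<Prod>j\<leftarrow>[1..<k]. z_sign n j i) = jw_sign n k i" for i
    unfolding jw_sign_def by (simp add: prod.distinct_set_conv_list[symmetric])
  then show ?thesis using assms by (subst z_string_monomial) auto
qed

lemma majorana_qubit_in_range: "\<mu> \<in> {1..2 * n} \<Longrightarrow> (\<mu> + 1) div 2 \<in> {1..n :: nat}"
  by auto

lemma majorana_monomial:
  assumes "\<mu> \<in> {1..2 * n}"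
  shows "majorana n \<mu> = monomial_mat (2 ^ n) (flip_bit (n - (\<mu> + 1) div 2)) (majorana_coeff n \<mu>)"
proof -
  define k where "k = (\<mu> + 1) div 2"
  have k: "k \<in> {1..n}" using majorana_qubit_in_range[OF assms] unfolding k_def .
  have coeff: "majorana_coeff n \<mu> =
      (\<lambda>i. jw_sign n k i * (if odd \<mu> then 1 else if bit i (n - k) then \<i> else - \<i>))"
    unfolding majorana_coeff_def k_def ..
  have string: "mat_prod_list (2 ^ n) (map (\<lambda>j. on_qubit n j pauli_z) [1..<k]) =
      monomial_mat (2 ^ n) (\<lambda>i. i) (jw_sign n k)"
    using k by (intro z_string_upt_monomial) simp
  show ?thesis
    unfolding majorana_def Let_def k_def[symmetric] coeff string
    by (cases "odd \<mu>") (simp_all add: on_qubit_pauli_monomial[OF k] monomial_mat_mult)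
qed

lemma majorana_carrier [simp]:
  "\<mu> \<in> {1..2 * n} \<Longrightarrow> majorana n \<mu> \<in> carrier_mat (2 ^ n) (2 ^ n)"
  by (simp add: majorana_monomial)

lemma z_sign_flip:
  assumes "l \<in> {1..n}" "k \<in> {1..n}"
  shows "z_sign n k (flip_bit (n - l) i) = (if l = k then - z_sign n k i else z_sign n k i)"
  using assms unfolding z_sign_def by (auto simp: bit_flip_bit_nat)

lemma jw_sign_flip:
  assumes "l \<in> {1..n}" "k \<in> {1..n}"
  shows "jw_sign n k (flip_bit (n - l) i) = (if l < k then - jw_sign n k i else jw_sign n k i)"
proof -
  have "jw_sign n k (flip_bit (n - l) i) = (\<Prod>j\<in>{1..<k}. (if j = l then - 1 else 1) * z_sign n j i)"
    unfolding jw_sign_def using assms by (intro prod.cong) (auto simp: z_sign_flip)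
  also have "\<dots> = (\<Prod>j\<in>{1..<k}. if j = l then - 1 else 1) * jw_sign n k i"
    by (simp add: prod.distrib jw_sign_def)
  also have "(\<Prod>j\<in>{1..<k}. if j = l then - 1 else (1 :: complex)) = (if l < k then - 1 else 1)"
    using assms by (subst prod.delta) auto
  finally show ?thesis by auto
qed

lemma jw_sign_square [simp]: "jw_sign n k i * jw_sign n k i = 1"
  unfolding jw_sign_def prod.distrib[symmetric] by (intro prod.neutral) (auto simp: z_sign_def)

lemma jw_sign_cnj [simp]: "cnj (jw_sign n k i) = jw_sign n k i"
  unfolding jw_sign_def cnj_prod by (intro prod.cong) (auto simp: z_sign_def)

text \<open>All commutation relations below reduce to this sign. A flip at l reverses one factor of
  the string when l lies before the qubit of \<open>\<mu>\<close>, and the phase of Y when l is that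
  qubit and \<open>\<mu>\<close> is even.\<close>

lemma majorana_coeff_flip:
  assumes m: "\<mu> \<in> {1..2 * n}" and l: "l \<in> {1..n}"
  shows "majorana_coeff n \<mu> (flip_bit (n - l) i) =
    (if l < (\<mu> + 1) div 2 \<or> (l = (\<mu> + 1) div 2 \<and> even \<mu>) then - majorana_coeff n \<mu> i else majorana_coeff n \<mu> i)"
proof -
  define k where "k = (\<mu> + 1) div 2"
  have k: "k \<in> {1..n}" using majorana_qubit_in_range[OF m] unfolding k_def .
  have b: "bit (flip_bit (n - l) i) (n - k) = (if l = k then \<not> bit i (n - k) else bit i (n - k))"
    using k l by (auto simp: bit_flip_bit_nat)
  show ?thesis
    unfolding majorana_coeff_def k_def[symmetric] b jw_sign_flip[OF l k]
    by (cases "odd \<mu>"; cases "l = k"; simp)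
qed

lemma qubit_flip_less:
  assumes "l \<in> {1..n}" "i < 2 ^ n"
  shows "flip_bit (n - l) i < (2 :: nat) ^ n"
  using assms by (intro flip_bit_less) auto

lemma majorana_square [simp]:
  assumes m: "\<mu> \<in> {1..2 * n}"
  shows "majorana n \<mu> * majorana n \<mu> = 1\<^sub>m (2 ^ n)"
proof -
  let ?k = "(\<mu> + 1) div 2"
  have k: "?k \<in> {1..n}" using majorana_qubit_in_range[OF m] .
  have "majorana_coeff n \<mu> i * majorana_coeff n \<mu> (flip_bit (n - ?k) i) = 1" for i
    using jw_sign_square[of n ?k i] unfolding majorana_coeff_flip[OF m k]
    by (auto simp: majorana_coeff_def algebra_simps)
  then show ?thesis unfolding majorana_monomial[OF m]
    by (subst monomial_mat_mult) (simp_all only: qubit_flip_less[OF k] flip_bit_flip_bit monomial_mat_one)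
qed

text \<open>Both orders flip the same bits, so only coefficients are compared, and exactly one order
  picks up a sign. On different qubits it comes from the string of the later operator, which crosses
  the qubit of the earlier one; on the same qubit it comes from the Y.\<close>

lemma majorana_anticommute:
  assumes m: "\<mu> \<in> {1..2 * n}" and v: "\<nu> \<in> {1..2 * n}" and ne: "\<mu> \<noteq> \<nu>"
  shows "majorana n \<mu> * majorana n \<nu> = - 1 \<cdot>\<^sub>m (majorana n \<nu> * majorana n \<mu>)"
proof -
  let ?k = "(\<mu> + 1) div 2" and ?l = "(\<nu> + 1) div 2"
  have k: "?k \<in> {1..n}" "?l \<in> {1..n}" using majorana_qubit_in_range m v by blast+
  have par: "?k = ?l \<Longrightarrow> odd \<mu> \<noteq> odd \<nu>" using ne by presburger
  have "majorana_coeff n \<mu> i * majorana_coeff n \<nu> (flip_bit (n - ?k) i) =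
    - (majorana_coeff n \<nu> i * majorana_coeff n \<mu> (flip_bit (n - ?l) i))" for i
  proof (rule linorder_cases[of ?k ?l])
    assume "?k = ?l"
    then show ?thesis using par
      unfolding majorana_coeff_flip[OF m k(2)] majorana_coeff_flip[OF v k(1)]
      by (cases "odd \<mu>") (simp_all del: One_nat_def)
  next
    assume "?k < ?l"
    then have "\<not> (?l < ?k \<or> ?l = ?k \<and> even \<mu>)" "?k < ?l \<or> ?k = ?l \<and> even \<nu>" by simp_all
    then show ?thesis
      unfolding majorana_coeff_flip[OF m k(2)] majorana_coeff_flip[OF v k(1)] by (simp only: if_True if_False mult.commute mult_minus_left mult_minus_right)
  next
    assume "?l < ?k"
    then have "?l < ?k \<or> ?l = ?k \<and> even \<mu>" "\<not> (?k < ?l \<or> ?k = ?l \<and> even \<nu>)" by simp_all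
    then show ?thesis
      unfolding majorana_coeff_flip[OF m k(2)] majorana_coeff_flip[OF v k(1)] by (simp only: if_True if_False mult.commute mult_minus_left mult_minus_right minus_minus)
  qed
  then show ?thesis unfolding majorana_monomial[OF m] majorana_monomial[OF v]
    by (subst (1 2) monomial_mat_mult)
       (simp_all add: qubit_flip_less[OF k(1)] qubit_flip_less[OF k(2)] monomial_mat_smult flip_bit_commute
          del: One_nat_def add_Suc_right add_0_right)
qed

lemma majorana_adjoint [simp]:
  assumes m: "\<mu> \<in> {1..2 * n}"
  shows "mat_adjoint (majorana n \<mu>) = majorana n \<mu>"
proof -
  let ?k = "(\<mu> + 1) div 2"
  have k: "?k \<in> {1..n}" using majorana_qubit_in_range[OF m] .
  have "cnj (majorana_coeff n \<mu> (flip_bit (n - ?k) i)) = majorana_coeff n \<mu> i" for i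
    unfolding majorana_coeff_flip[OF m k] by (auto simp: majorana_coeff_def)
  then show ?thesis unfolding majorana_monomial[OF m] by (subst monomial_mat_adjoint) auto
qed

section \<open>Operators acting on few qubits and their small matrices\<close>

text \<open>Acting only on the qubits in qs, expressed as commutation with the Pauli operators of all other qubits:
  in this form closure under products and exponentials is immediate.\<close>

definition supported_on :: "nat \<Rightarrow> nat list \<Rightarrow> complex mat \<Rightarrow> bool" where
  "supported_on n qs A \<longleftrightarrow> A \<in> carrier_mat (2 ^ n) (2 ^ n) \<and>
     (\<forall>k\<in>{1..n} - set qs. \<forall>P\<in>{pauli_x, pauli_z}. A * on_qubit n k P = on_qubit n k P * A)"

lemma supported_onD:
  assumes "supported_on n qs A"
  shows "A \<in> carrier_mat (2 ^ n) (2 ^ n)"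
    and "k \<in> {1..n} \<Longrightarrow> k \<notin> set qs \<Longrightarrow> P \<in> {pauli_x, pauli_z} \<Longrightarrow> A * on_qubit n k P = on_qubit n k P * A"
  using assms unfolding supported_on_def by auto

text \<open>Commuting with X at k means that f and c respect the flip of that bit; commuting with Z
  means that f preserves the bit.\<close>

lemma supported_on_monomial:
  assumes f: "\<And>i. i < 2 ^ n \<Longrightarrow> f i < 2 ^ n"
    and inv: "\<And>k i. k \<in> {1..n} - set qs \<Longrightarrow> f (flip_bit (n - k) i) = flip_bit (n - k) (f i) \<and>
      c (flip_bit (n - k) i) = c i \<and> bit (f i) (n - k) = bit i (n - k)"
  shows "supported_on n qs (monomial_mat (2 ^ n) f c)"
  using assms unfolding supported_on_def
  by (auto simp: on_qubit_pauli_monomial monomial_mat_mult qubit_flip_less z_sign_def intro!: monomial_mat_cong)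

text \<open>Commutation with X at an outside qubit, read entrywise. Together with its counterpart
  for Z, which kills entries whose row and column differ there, it forces a small matrix on qs
  tensored with the identity.\<close>

lemma supported_on_entry_flip:
  assumes A: "supported_on n qs A" and k: "k \<in> {1..n}" "k \<notin> set qs" and ij: "i < 2 ^ n" "j < 2 ^ n"
  shows "A $$ (flip_bit (n - k) i, flip_bit (n - k) j) = A $$ (i, j)"
proof -
  have "(A * on_qubit n k pauli_x) $$ (flip_bit (n - k) i, j) = (on_qubit n k pauli_x * A) $$ (flip_bit (n - k) i, j)"
    using supported_onD(2)[OF A k, of pauli_x] by simp
  then show ?thesis
    using supported_onD(1)[OF A] k ij
    by (simp add: on_qubit_pauli_monomial monomial_mat_mult_right_entry monomial_mat_mult_left_entry
        qubit_flip_less del: index_mult_mat)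
qed

lemma supported_on_entry_zero:
  assumes A: "supported_on n qs A" and k: "k \<in> {1..n}" "k \<notin> set qs" and ij: "i < 2 ^ n" "j < 2 ^ n"
    and ne: "bit i (n - k) \<noteq> bit j (n - k)"
  shows "A $$ (i, j) = 0"
proof -
  have "(A * on_qubit n k pauli_z) $$ (i, j) = (on_qubit n k pauli_z * A) $$ (i, j)"
    using supported_onD(2)[OF A k, of pauli_z] by simp
  then have "A $$ (i, j) * z_sign n k j = z_sign n k i * A $$ (i, j)"
    using supported_onD(1)[OF A] k ij
    by (simp add: on_qubit_pauli_monomial monomial_mat_mult_right_entry monomial_mat_mult_left_entry
        del: index_mult_mat)
  then show ?thesis using ne by (auto simp: z_sign_def split: if_splits)
qed

text \<open>A right inverse of \<open>sub_index\<close> (for distinct qubits in range): the bits of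
  a are spread over the qubits in qs and all other bits are 0. The first listed qubit is the most
  significant, hence \<open>length qs - 1 - r\<close>.\<close>

definition embed_index :: "nat \<Rightarrow> nat list \<Rightarrow> nat \<Rightarrow> nat" where
  "embed_index n qs a =
     horner_sum of_bool 2 (map (\<lambda>p. \<exists>r<length qs. p = n - qs ! r \<and> bit a (length qs - 1 - r)) [0..<n])"

lemma bit_embed_index:
  "bit (embed_index n qs a) p \<longleftrightarrow> p < n \<and> (\<exists>r<length qs. p = n - qs ! r \<and> bit a (length qs - 1 - r))"
  unfolding embed_index_def by (auto simp: bit_horner_sum_bit_iff)

lemma horner_sum_bits_less: "horner_sum of_bool 2 bs < (2 :: nat) ^ length bs"
  by (induction bs) auto

lemma embed_index_less: "embed_index n qs a < 2 ^ n"
  unfolding embed_index_def by (rule order_less_le_trans[OF horner_sum_bits_less]) simp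

lemma sub_index_horner:
  "sub_index n qs i = horner_sum of_bool 2 (map (\<lambda>q. bit i (n - qs ! (length qs - 1 - q))) [0..<length qs])"
  unfolding sub_index_def horner_sum_eq_sum qubit_bit_eq
  by (simp add: atLeast0LessThan[symmetric])
     (rule sum.reindex_bij_witness[where i = "\<lambda>r. length qs - 1 - r" and j = "\<lambda>r. length qs - 1 - r"], auto)

lemma bit_sub_index:
  "bit (sub_index n qs i) q \<longleftrightarrow> q < length qs \<and> bit i (n - qs ! (length qs - 1 - q))"
  unfolding sub_index_horner by (auto simp: bit_horner_sum_bit_iff)

lemma sub_index_less: "sub_index n qs i < 2 ^ length qs"
  unfolding sub_index_horner by (rule order_less_le_trans[OF horner_sum_bits_less]) simp

lemma bit_embed_index_on:
  assumes "distinct qs" "set qs \<subseteq> {1..n}" "r < length qs"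
  shows "bit (embed_index n qs a) (n - qs ! r) \<longleftrightarrow> bit a (length qs - 1 - r)"
proof -
  have *: "qs ! s \<in> {1..n}" if "s < length qs" for s using assms that nth_mem by blast
  have "s = r" if "s < length qs" "n - qs ! r = n - qs ! s" for s
  proof -
    have "qs ! s = qs ! r" using *[OF that(1)] *[OF assms(3)] that(2) by auto
    then show ?thesis using assms that nth_eq_iff_index_eq by blast
  qed
  then show ?thesis using *[OF assms(3)] assms(3) unfolding bit_embed_index by auto
qed

lemma bit_embed_index_off:
  assumes "set qs \<subseteq> {1..n}" "k \<in> {1..n}" "k \<notin> set qs"
  shows "\<not> bit (embed_index n qs a) (n - k)"
proof
  assume "bit (embed_index n qs a) (n - k)"
  then obtain r where "r < length qs" "n - k = n - qs ! r" unfolding bit_embed_index by auto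
  moreover from this have r: "qs ! r \<in> set qs" by simp
  moreover from r have "qs ! r \<in> {1..n}" using assms(1) by blast
  ultimately have "qs ! r = k" using assms(2) by simp arith
  with r show False using assms(3) by simp
qed

lemma sub_index_embed_index:
  assumes "distinct qs" "set qs \<subseteq> {1..n}" "a < 2 ^ length qs"
  shows "sub_index n qs (embed_index n qs a) = a"
proof (rule nat_eq_bitsI[OF sub_index_less assms(3)])
  fix p assume p: "p < length qs"
  then show "bit (sub_index n qs (embed_index n qs a)) p = bit a p"
    using bit_embed_index_on[OF assms(1,2), of "length qs - 1 - p" a] unfolding bit_sub_index by simp
qed

lemma embed_index_sub_indexI:
  assumes qs: "distinct qs" "set qs \<subseteq> {1..n}" and i: "i < 2 ^ n" "i' < 2 ^ n"
    and off: "\<And>k. k \<in> {1..n} - set qs \<Longrightarrow> \<not> bit i' (n - k)"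
    and on: "\<And>k. k \<in> set qs \<Longrightarrow> bit i' (n - k) = bit i (n - k)"
  shows "embed_index n qs (sub_index n qs i) = i'"
proof (rule nat_eq_bitsI[OF embed_index_less i(2)])
  fix p assume p: "p < n"
  define k where "k = n - p"
  have k: "k \<in> {1..n}" "p = n - k" using p by (auto simp: k_def)
  show "bit (embed_index n qs (sub_index n qs i)) p = bit i' p"
  proof (cases "k \<in> set qs")
    case True
    then obtain r where r: "r < length qs" "qs ! r = k" by (meson in_set_conv_nth)
    then show ?thesis
      using bit_embed_index_on[OF qs r(1), of "sub_index n qs i"] on[OF True] k
      by (simp add: bit_sub_index) arith
  next
    case False
    then show ?thesis using bit_embed_index_off[OF qs(2) k(1)] off[of k] k by auto
  qed
qed

text \<open>Outside qs the row and the column agree, so a set bit is set in both and one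
  simultaneous flip clears it without changing the entry. With S all outside qubits, the entry is
  moved to indices in the image of \<open>embed_index\<close>.\<close>

lemma supported_on_clear:
  assumes A: "supported_on n qs A" and ij: "i < 2 ^ n" "j < 2 ^ n"
    and agree: "\<And>k. k \<in> {1..n} - set qs \<Longrightarrow> bit i (n - k) = bit j (n - k)"
    and S: "S \<subseteq> {1..n} - set qs"
  shows "\<exists>i' j'. i' < 2 ^ n \<and> j' < 2 ^ n \<and> A $$ (i', j') = A $$ (i, j) \<and>
    (\<forall>k\<in>S. \<not> bit i' (n - k) \<and> \<not> bit j' (n - k)) \<and>
    (\<forall>k\<in>{1..n} - S. bit i' (n - k) = bit i (n - k) \<and> bit j' (n - k) = bit j (n - k))"
proof -
  have "finite S" using S finite_subset by blast
  then show ?thesis using S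
  proof induction
    case empty
    then show ?case using ij by auto
  next
    case (insert k S)
    then obtain i' j' where IH: "i' < 2 ^ n" "j' < 2 ^ n" "A $$ (i', j') = A $$ (i, j)"
      "\<forall>k\<in>S. \<not> bit i' (n - k) \<and> \<not> bit j' (n - k)"
      "\<forall>k\<in>{1..n} - S. bit i' (n - k) = bit i (n - k) \<and> bit j' (n - k) = bit j (n - k)" by auto
    have k: "k \<in> {1..n}" "k \<notin> set qs" and kS: "k \<notin> S" using insert by auto
    have ne: "n - k' = n - k \<longleftrightarrow> k' = k" if "k' \<in> {1..n}" for k' using that k by auto
    have S': "S \<subseteq> {1..n}" using insert.prems by auto
    show ?case
    proof (cases "bit i (n - k)")
      case True
      then have "bit i' (n - k)" "bit j' (n - k)" using IH(5) k kS agree[of k] by auto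
      then have "\<not> bit (flip_bit (n - k) i') (n - k')" "\<not> bit (flip_bit (n - k) j') (n - k')"
        if "k' \<in> insert k S" for k'
        using that IH(4) ne[of k'] S' kS by (auto simp: bit_flip_bit_nat)
      moreover have "bit (flip_bit (n - k) i') (n - k') = bit i (n - k')"
        "bit (flip_bit (n - k) j') (n - k') = bit j (n - k')" if "k' \<in> {1..n} - insert k S" for k'
        using that IH(5) ne[of k'] by (auto simp: bit_flip_bit_nat)
      ultimately show ?thesis
        using supported_on_entry_flip[OF A k IH(1,2)] IH(3)
          qubit_flip_less[OF k(1) IH(1)] qubit_flip_less[OF k(1) IH(2)]
        by (intro exI[of _ "flip_bit (n - k) i'"] exI[of _ "flip_bit (n - k) j'"]) simp
    next
      case False
      then have "\<not> bit i' (n - k)" "\<not> bit j' (n - k)" using IH(5) k kS agree[of k] by auto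
      then have "\<forall>k'\<in>insert k S. \<not> bit i' (n - k') \<and> \<not> bit j' (n - k')" using IH(4) by blast
      moreover have "\<forall>k'\<in>{1..n} - insert k S. bit i' (n - k') = bit i (n - k') \<and> bit j' (n - k') = bit j (n - k')"
        using IH(5) by blast
      ultimately show ?thesis using IH(1-3) by blast
    qed
  qed
qed

text \<open>The small matrix is read off where all outside bits are 0. If outside bits of row and
  column agree, they can be cleared; if they differ, both sides vanish.\<close>

lemma supported_on_eq_on_qubits:
  assumes A: "supported_on n qs A" and qs: "distinct qs" "set qs \<subseteq> {1..n}"
    and m: "m = 2 ^ length qs"
  shows "A = on_qubits n qs (mat m m (\<lambda>(a, b). A $$ (embed_index n qs a, embed_index n qs b)))"
proof (rule square_mat_eqI[of _ "2 ^ n"])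
  show "A \<in> carrier_mat (2 ^ n) (2 ^ n)" using supported_onD(1)[OF A] .
  fix i j :: nat assume ij: "i < 2 ^ n" "j < 2 ^ n"
  show "A $$ (i, j) = on_qubits n qs (mat m m (\<lambda>(a, b). A $$ (embed_index n qs a, embed_index n qs b))) $$ (i, j)"
  proof (cases "\<forall>k\<in>{1..n} - set qs. qubit_bit n i k = qubit_bit n j k")
    case True
    have agree: "bit i (n - k) = bit j (n - k)" if "k \<in> {1..n} - set qs" for k
      using True that by (simp only: qubit_bit_eq of_bool_eq_iff)
    obtain i' j' where c: "i' < 2 ^ n" "j' < 2 ^ n" "A $$ (i', j') = A $$ (i, j)"
      "\<forall>k\<in>{1..n} - set qs. \<not> bit i' (n - k) \<and> \<not> bit j' (n - k)"
      "\<forall>k\<in>{1..n} - ({1..n} - set qs). bit i' (n - k) = bit i (n - k) \<and> bit j' (n - k) = bit j (n - k)"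
      using supported_on_clear[OF A ij agree subset_refl] by blast
    have "embed_index n qs (sub_index n qs i) = i'" "embed_index n qs (sub_index n qs j) = j'"
      using c qs ij by (auto intro!: embed_index_sub_indexI)
    then show ?thesis using True ij c(3) sub_index_less[of n qs] unfolding on_qubits_def m by simp
  next
    case False
    then obtain k where k: "k \<in> {1..n} - set qs" "bit i (n - k) \<noteq> bit j (n - k)"
      unfolding qubit_bit_eq of_bool_eq_iff by blast
    then show ?thesis using supported_on_entry_zero[OF A _ _ ij, of k] False ij
      unfolding on_qubits_def by auto
  qed
qed (simp add: on_qubits_def)

text \<open>Unitarity descends to the small matrix. A column of A with index
  \<open>embed_index n qs b\<close> vanishes in every row with a set outside bit, so the inner
  products of the columns of u are those of columns of A.\<close>

lemma supported_on_unitary_qubit_gate: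
  assumes A: "supported_on n qs A" and qs: "distinct qs" "set qs \<subseteq> {1..n}" "length qs \<le> l"
    and U: "unitary_mat (2 ^ n) A"
  shows "qubit_local_gate n l A"
proof -
  define m :: nat where "m = 2 ^ length qs"
  let ?e = "embed_index n qs"
  define u where "u = mat m m (\<lambda>(a, b). A $$ (?e a, ?e b))"
  have uc: "u \<in> carrier_mat m m" unfolding u_def by simp
  note Ac = supported_onD(1)[OF A]
  have inj: "inj_on ?e {..<m}"
    using sub_index_embed_index[OF qs(1,2)] unfolding m_def by (metis inj_on_inverseI lessThan_iff)
  have "mat_adjoint u * u = 1\<^sub>m m"
  proof (rule square_mat_eqI[of _ m])
    fix a b assume ab: "a < m" "b < m"
    have "(mat_adjoint u * u) $$ (a, b) = (\<Sum>c<m. mat_adjoint u $$ (a, c) * u $$ (c, b))"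
      using uc ab by (intro mult_mat_entry) auto
    also have "\<dots> = (\<Sum>c<m. cnj (A $$ (?e c, ?e a)) * A $$ (?e c, ?e b))"
      using uc ab by (intro sum.cong) (auto simp: u_def)
    also have "\<dots> = (\<Sum>l\<in>?e ` {..<m}. cnj (A $$ (l, ?e a)) * A $$ (l, ?e b))"
      by (simp add: sum.reindex[OF inj])
    also have "\<dots> = (\<Sum>l<2 ^ n. cnj (A $$ (l, ?e a)) * A $$ (l, ?e b))"
    proof (rule sum.mono_neutral_left)
      show "\<forall>l\<in>{..<2 ^ n} - ?e ` {..<m}. cnj (A $$ (l, ?e a)) * A $$ (l, ?e b) = 0"
      proof
        fix l assume l: "l \<in> {..<2 ^ n} - ?e ` {..<m}"
        have "\<exists>k\<in>{1..n} - set qs. bit l (n - k)"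
        proof (rule ccontr)
          assume "\<not> ?thesis"
          then have "?e (sub_index n qs l) = l" using l qs by (intro embed_index_sub_indexI) auto
          then show False using l sub_index_less[of n qs l] unfolding m_def by (metis DiffD2 imageI lessThan_iff)
        qed
        then obtain k where "k \<in> {1..n} - set qs" "bit l (n - k)" by blast
        then show "cnj (A $$ (l, ?e a)) * A $$ (l, ?e b) = 0"
          using supported_on_entry_zero[OF A, of k l "?e b"] bit_embed_index_off[OF qs(2), of k b] l
            embed_index_less[of n qs b] by auto
      qed
    qed (auto simp: embed_index_less)
    also have "\<dots> = (\<Sum>l<2 ^ n. mat_adjoint A $$ (?e a, l) * A $$ (l, ?e b))"
      using Ac embed_index_less[of n qs] by (intro sum.cong) auto
    also have "\<dots> = (mat_adjoint A * A) $$ (?e a, ?e b)"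
      using Ac embed_index_less[of n qs] by (intro mult_mat_entry[symmetric]) auto
    also have "\<dots> = 1\<^sub>m m $$ (a, b)"
      using unitary_matD(3)[OF U] ab inj embed_index_less[of n qs] by (auto simp: inj_on_def)
    finally show "(mat_adjoint u * u) $$ (a, b) = 1\<^sub>m m $$ (a, b)" .
  qed (use uc in auto)
  moreover from this have "u * mat_adjoint u = 1\<^sub>m m"
    using mat_mult_left_right_inverse[of "mat_adjoint u" m u] uc by auto
  ultimately have "unitary_mat m u" using uc unfolding unitary_mat_def by auto
  then show ?thesis
    using supported_on_eq_on_qubits[OF A qs(1,2) m_def] qs unfolding qubit_local_gate_def u_def m_def by blast
qed

text \<open>Schur's lemma for the full matrix algebra, obtained as the case of no qubits: the small
  matrix is one by one.\<close>

lemma supported_on_nil_scalar: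
  assumes A: "supported_on n [] A"
  shows "\<exists>c. A = c \<cdot>\<^sub>m 1\<^sub>m (2 ^ n)"
proof -
  define c where "c = A $$ (embed_index n [] 0, embed_index n [] 0)"
  have "A = on_qubits n [] (mat 1 1 (\<lambda>(a, b). A $$ (embed_index n [] a, embed_index n [] b)))"
    by (rule supported_on_eq_on_qubits[OF A]) simp_all
  also have "mat 1 1 (\<lambda>(a, b). A $$ (embed_index n [] a, embed_index n [] b)) = mat 1 1 (\<lambda>_. c)"
    by (rule eq_matI) (simp_all add: c_def)
  also have "on_qubits n [] (mat 1 1 (\<lambda>_. c)) = c \<cdot>\<^sub>m 1\<^sub>m (2 ^ n)"
  proof (rule square_mat_eqI[of _ "2 ^ n"])
    fix i j :: nat assume ij: "i < 2 ^ n" "j < 2 ^ n"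
    have "(\<forall>k\<in>{1..n}. bit i (n - k) = bit j (n - k)) \<longleftrightarrow> i = j"
    proof
      assume *: "\<forall>k\<in>{1..n}. bit i (n - k) = bit j (n - k)"
      show "i = j"
      proof (rule nat_eq_bitsI[OF ij])
        fix p assume "p < n"
        then show "bit i p = bit j p" using *[rule_format, of "n - p"] by simp
      qed
    qed auto
    then show "on_qubits n [] (mat 1 1 (\<lambda>_. c)) $$ (i, j) = (c \<cdot>\<^sub>m 1\<^sub>m (2 ^ n)) $$ (i, j)"
      using ij unfolding on_qubits_def by (auto simp: qubit_bit_eq sub_index_def)
  qed (auto simp: on_qubits_def)
  finally show ?thesis by blast
qed

subsection \<open>Local gates and circuits\<close>

lemma mat_commute_mult:
  assumes "A \<in> carrier_mat d d" "B \<in> carrier_mat d d" "C \<in> carrier_mat d d"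
    and "A * B = B * A" "A * C = C * A"
  shows "A * (B * C) = B * C * A"
proof -
  have "A * (B * C) = (A * B) * C" using assms(1-3) by (simp add: assoc_mult_mat[of _ d d _ d _ d])
  also have "\<dots> = B * (A * C)" using assms(1-3) by (simp add: assms(4) assoc_mult_mat[of _ d d _ d _ d])
  also have "\<dots> = B * C * A" using assms(1-3) by (simp add: assms(5) assoc_mult_mat[of _ d d _ d _ d])
  finally show ?thesis .
qed

lemma on_qubit_pauli_square:
  assumes "k \<in> {1..n}" "P \<in> {pauli_x, pauli_z}"
  shows "on_qubit n k P * on_qubit n k P = 1\<^sub>m (2 ^ n)"
  using assms qubit_flip_less[OF assms(1)]
  by (auto simp: on_qubit_pauli_monomial monomial_mat_mult z_sign_def monomial_mat_one[symmetric]
      intro!: monomial_mat_cong)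

lemma supported_on_one [simp]: "supported_on n qs (1\<^sub>m (2 ^ n))"
  unfolding supported_on_def by (auto simp: on_qubit_carrier[THEN left_mult_one_mat] on_qubit_carrier[THEN right_mult_one_mat])

lemma supported_on_add:
  assumes "supported_on n qs A" "supported_on n qs B"
  shows "supported_on n qs (A + B)"
  unfolding supported_on_def
proof (intro conjI ballI)
  show "A + B \<in> carrier_mat (2 ^ n) (2 ^ n)"
    using assms[THEN supported_onD(1)] by simp
  fix k P assume k: "k \<in> {1..n} - set qs" and P: "P \<in> {pauli_x, pauli_z}"
  have "on_qubit n k P \<in> carrier_mat (2 ^ n) (2 ^ n)" using k P by auto
  then show "(A + B) * on_qubit n k P = on_qubit n k P * (A + B)"
    using assms[THEN supported_onD(1)] assms[THEN supported_onD(2), of k P] k P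
    by (simp add: add_mult_distrib_mat[of _ "2 ^ n" "2 ^ n"] mult_add_distrib_mat[of _ "2 ^ n" "2 ^ n"])
qed

lemma supported_on_mult:
  assumes "supported_on n qs A" "supported_on n qs B"
  shows "supported_on n qs (A * B)"
  unfolding supported_on_def
proof (intro conjI ballI)
  show "A * B \<in> carrier_mat (2 ^ n) (2 ^ n)"
    using assms[THEN supported_onD(1)] by simp
  fix k P assume k: "k \<in> {1..n} - set qs" and P: "P \<in> {pauli_x, pauli_z}"
  have "on_qubit n k P \<in> carrier_mat (2 ^ n) (2 ^ n)" using k P by auto
  then show "A * B * on_qubit n k P = on_qubit n k P * (A * B)"
    using assms[THEN supported_onD(1)] assms[THEN supported_onD(2), of k P] k P
    by (intro mat_commute_mult[symmetric, of _ "2 ^ n"]) auto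
qed

lemma supported_on_smult:
  assumes "supported_on n qs A"
  shows "supported_on n qs (c \<cdot>\<^sub>m A)"
  unfolding supported_on_def
proof (intro conjI ballI)
  show "c \<cdot>\<^sub>m A \<in> carrier_mat (2 ^ n) (2 ^ n)"
    using assms[THEN supported_onD(1)] by simp
  fix k P assume k: "k \<in> {1..n} - set qs" and P: "P \<in> {pauli_x, pauli_z}"
  have "on_qubit n k P \<in> carrier_mat (2 ^ n) (2 ^ n)" using k P by auto
  then show "c \<cdot>\<^sub>m A * on_qubit n k P = on_qubit n k P * (c \<cdot>\<^sub>m A)"
    using assms[THEN supported_onD(1)] assms[THEN supported_onD(2), of k P] k P
    by (simp add: mult_smult_distrib[of _ "2 ^ n" "2 ^ n"] mult_smult_assoc_mat[of _ "2 ^ n" "2 ^ n"])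
qed

text \<open>Commuting with an involution means being fixed under conjugation by it, and
  \<open>mat_exp_conj\<close> passes this property to the exponential.\<close>

lemma supported_on_exp:
  assumes A: "supported_on n qs A"
  shows "supported_on n qs (mat_exp A)"
  unfolding supported_on_def
proof (intro conjI ballI)
  note Ac = supported_onD(1)[OF A]
  show "mat_exp A \<in> carrier_mat (2 ^ n) (2 ^ n)" using Ac by simp
  fix k P assume k: "k \<in> {1..n} - set qs" and P: "P \<in> {pauli_x, pauli_z}"
  let ?U = "on_qubit n k P"
  have U: "?U \<in> carrier_mat (2 ^ n) (2 ^ n)" "?U * ?U = 1\<^sub>m (2 ^ n)"
    using k P on_qubit_pauli_square[of k n P] by auto
  have E: "mat_exp A \<in> carrier_mat (2 ^ n) (2 ^ n)" using Ac by simp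
  have "?U * A = A * ?U"
    using supported_onD(2)[OF A, of k P] k P by auto
  then have "?U * A * ?U = A * (?U * ?U)"
    using Ac U(1) by (simp add: assoc_mult_mat[of A "2 ^ n" "2 ^ n" _ "2 ^ n" _ "2 ^ n"])
  then have "?U * A * ?U = A" using U(2) Ac by simp
  then have "mat_exp A = ?U * mat_exp A * ?U"
    using mat_exp_conj[OF Ac U(1) U(1) U(2) U(2)] by simp
  then have "mat_exp A * ?U = ?U * mat_exp A * ?U * ?U" by simp
  also have "\<dots> = ?U * mat_exp A * (?U * ?U)"
    using U(1) E by (simp add: assoc_mult_mat[of _ "2 ^ n" "2 ^ n" _ "2 ^ n" _ "2 ^ n"])
  also have "\<dots> = ?U * mat_exp A" using U E by simp
  finally show "mat_exp A * ?U = ?U * mat_exp A" .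
qed

section \<open>Gates that are local in both senses, and circuits of them\<close>

text \<open>Both kinds of locality are imposed on the same Hermitian generator, so that every gate
  counts for both complexities and one circuit yields both bounds.\<close>

definition local_generator :: "nat \<Rightarrow> nat \<Rightarrow> complex mat \<Rightarrow> bool" where
  "local_generator n l H \<longleftrightarrow> hermitian_mat (2 ^ n) H \<and>
     (\<exists>M. M \<subseteq> {1..2 * n} \<and> card M \<le> l \<and> H \<in> generated_algebra (2 ^ n) (majorana n ` M)) \<and>
     (\<exists>qs. distinct qs \<and> set qs \<subseteq> {1..n} \<and> length qs \<le> l \<and> supported_on n qs H)"

lemma local_generatorI:
  assumes "hermitian_mat (2 ^ n) H" "M \<subseteq> {1..2 * n}" "card M \<le> l"
    "H \<in> generated_algebra (2 ^ n) (majorana n ` M)"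
    "distinct qs" "set qs \<subseteq> {1..n}" "length qs \<le> l" "supported_on n qs H"
  shows "local_generator n l H"
  using assms unfolding local_generator_def by blast

lemma local_generator_majorana_gate:
  "local_generator n l H \<Longrightarrow> majorana_local_gate n l (mat_exp (\<i> \<cdot>\<^sub>m H))"
  unfolding local_generator_def majorana_local_gate_def by blast

lemma local_generator_qubit_gate:
  assumes "local_generator n l H"
  shows "qubit_local_gate n l (mat_exp (\<i> \<cdot>\<^sub>m H))"
proof -
  obtain qs where qs: "distinct qs" "set qs \<subseteq> {1..n}" "length qs \<le> l" "supported_on n qs H"
    using assms unfolding local_generator_def by blast
  have "unitary_mat (2 ^ n) (mat_exp (\<i> \<cdot>\<^sub>m H))"
    using assms unitary_mat_exp unfolding local_generator_def by blast
  then show ?thesis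
    using supported_on_unitary_qubit_gate[OF supported_on_exp[OF supported_on_smult[OF qs(4)]] qs(1-3)] by blast
qed

lemma hermitian_smult_real:
  assumes "hermitian_mat d H"
  shows "hermitian_mat d (complex_of_real x \<cdot>\<^sub>m H)"
  using assms unfolding hermitian_mat_def by (auto simp: mat_adjoint_smult)

lemma local_generator_smult_real:
  assumes "local_generator n l H"
  shows "local_generator n l (complex_of_real x \<cdot>\<^sub>m H)"
proof -
  obtain M qs where *: "M \<subseteq> {1..2 * n}" "card M \<le> l" "H \<in> generated_algebra (2 ^ n) (majorana n ` M)"
    "distinct qs" "set qs \<subseteq> {1..n}" "length qs \<le> l" "supported_on n qs H"
    using assms unfolding local_generator_def by blast
  have "hermitian_mat (2 ^ n) H" using assms unfolding local_generator_def by blast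
  then show ?thesis using *
    by (intro local_generatorI[of _ _ M _ qs] hermitian_smult_real supported_on_smult generated_algebra.smult)
qed

lemma mat_prod_list_simps [simp]:
  "mat_prod_list d [] = 1\<^sub>m d" "mat_prod_list d (A # As) = A * mat_prod_list d As"
  unfolding mat_prod_list_def by simp_all

lemma mat_prod_list_carrier:
  assumes "\<And>A. A \<in> set As \<Longrightarrow> A \<in> carrier_mat d d"
  shows "mat_prod_list d As \<in> carrier_mat d d"
  using assms by (induction As) auto

lemma mat_prod_list_append:
  assumes "\<And>A. A \<in> set As \<union> set Bs \<Longrightarrow> A \<in> carrier_mat d d"
  shows "mat_prod_list d (As @ Bs) = mat_prod_list d As * mat_prod_list d Bs"
  using assms
proof (induction As)
  case Nil
  then show ?case using mat_prod_list_carrier[of Bs d] by simp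
next
  case (Cons A As)
  then show ?case using mat_prod_list_carrier[of As d] mat_prod_list_carrier[of Bs d]
    by (simp add: assoc_mult_mat[of _ d d _ d _ d])
qed

text \<open>N only bounds the number of gates, so costs add under products and may be weakened.
  Generators are listed rather than gates so that inverses are again visibly circuits.\<close>

definition circuit :: "nat \<Rightarrow> nat \<Rightarrow> nat \<Rightarrow> complex mat \<Rightarrow> bool" where
  "circuit n l N g \<longleftrightarrow> (\<exists>Hs. length Hs \<le> N \<and> (\<forall>H\<in>set Hs. local_generator n l H) \<and>
     g = mat_prod_list (2 ^ n) (map (\<lambda>H. mat_exp (\<i> \<cdot>\<^sub>m H)) Hs))"

lemma local_generator_unitary:
  "local_generator n l H \<Longrightarrow> unitary_mat (2 ^ n) (mat_exp (\<i> \<cdot>\<^sub>m H))"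
  unfolding local_generator_def by (auto intro: unitary_mat_exp)

lemma circuit_one [simp]: "circuit n l 0 (1\<^sub>m (2 ^ n))"
  unfolding circuit_def by simp

lemma circuit_gate:
  assumes "local_generator n l H"
  shows "circuit n l 1 (mat_exp (\<i> \<cdot>\<^sub>m H))"
  using assms unitary_matD(1)[OF local_generator_unitary[OF assms]]
  unfolding circuit_def by (intro exI[of _ "[H]"]) auto

lemma circuit_mult:
  assumes "circuit n l N g" "circuit n l N' h"
  shows "circuit n l (N + N') (g * h)"
proof -
  obtain Hs Hs' where *: "length Hs \<le> N" "\<forall>H\<in>set Hs. local_generator n l H"
    "g = mat_prod_list (2 ^ n) (map (\<lambda>H. mat_exp (\<i> \<cdot>\<^sub>m H)) Hs)"
    "length Hs' \<le> N'" "\<forall>H\<in>set Hs'. local_generator n l H"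
    "h = mat_prod_list (2 ^ n) (map (\<lambda>H. mat_exp (\<i> \<cdot>\<^sub>m H)) Hs')"
    using assms unfolding circuit_def by blast
  have "g * h = mat_prod_list (2 ^ n) (map (\<lambda>H. mat_exp (\<i> \<cdot>\<^sub>m H)) (Hs @ Hs'))"
    unfolding * map_append using *(2,5) unitary_matD(1)[OF local_generator_unitary]
    by (intro mat_prod_list_append[symmetric]) auto
  then show ?thesis unfolding circuit_def using * by (intro exI[of _ "Hs @ Hs'"]) auto
qed

lemma circuit_mono: "circuit n l N g \<Longrightarrow> N \<le> N' \<Longrightarrow> circuit n l N' g"
  unfolding circuit_def by (elim exE conjE, rule exI, intro conjI, erule order_trans)

lemma circuit_induct [consumes 1, case_names one gate]:
  assumes "circuit n l N g"
    and "\<And>N. P N (1\<^sub>m (2 ^ n))"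
    and "\<And>H N g. local_generator n l H \<Longrightarrow> circuit n l N g \<Longrightarrow> P N g \<Longrightarrow> P (Suc N) (mat_exp (\<i> \<cdot>\<^sub>m H) * g)"
  shows "P N g"
proof -
  obtain Hs where "length Hs \<le> N" "\<forall>H\<in>set Hs. local_generator n l H"
    "g = mat_prod_list (2 ^ n) (map (\<lambda>H. mat_exp (\<i> \<cdot>\<^sub>m H)) Hs)"
    using assms(1) unfolding circuit_def by blast
  then show ?thesis
  proof (induction Hs arbitrary: N g)
    case Nil
    then show ?case using assms(2) by simp
  next
    case (Cons H Hs)
    obtain N' where N: "N = Suc N'" "length Hs \<le> N'" using Cons.prems(1) by (cases N) auto
    let ?h = "mat_prod_list (2 ^ n) (map (\<lambda>H. mat_exp (\<i> \<cdot>\<^sub>m H)) Hs)"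
    have "circuit n l N' ?h" using N(2) Cons.prems unfolding circuit_def by auto
    moreover have "P N' ?h" using Cons.IH[OF N(2) _ refl] Cons.prems by simp
    ultimately show ?case using assms(3)[of H N' ?h] Cons.prems N by simp
  qed
qed

lemma circuit_unitary: "circuit n l N g \<Longrightarrow> unitary_mat (2 ^ n) g"
  by (induction rule: circuit_induct) (auto intro: unitary_mat_mult local_generator_unitary)

text \<open>An elimination is undone at equal cost: reverse the order and negate every
  generator.\<close>

lemma circuit_adjoint: "circuit n l N g \<Longrightarrow> circuit n l N (mat_adjoint g)"
proof (induction rule: circuit_induct)
  case (one N)
  then show ?case by (simp add: circuit_mono[OF circuit_one])
next
  case (gate H N g)
  have H: "hermitian_mat (2 ^ n) H" using gate.hyps(1) unfolding local_generator_def by blast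
  have "circuit n l 1 (mat_exp (\<i> \<cdot>\<^sub>m (- 1 \<cdot>\<^sub>m H)))"
    using circuit_gate[OF local_generator_smult_real[OF gate(1), of "-1"]] by simp
  from circuit_mult[OF gate.IH this] show ?case
    using unitary_matD(1)[OF circuit_unitary[OF gate(2)]] unitary_matD(1)[OF local_generator_unitary[OF gate(1)]]
    by (simp add: mat_adjoint_mult[of _ "2 ^ n"] mat_adjoint_exp_hermitian[OF H])
qed

lemma circuit_complexity_le:
  assumes "circuit n l N g"
  shows "qubit_circuit_complexity l n g \<le> enat N" "fermionic_circuit_complexity l n g \<le> enat N"
proof -
  obtain Hs where Hs: "length Hs \<le> N" "\<forall>H\<in>set Hs. local_generator n l H"
    "g = mat_prod_list (2 ^ n) (map (\<lambda>H. mat_exp (\<i> \<cdot>\<^sub>m H)) Hs)"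
    using assms unfolding circuit_def by blast
  have *: "circuit_complexity gate n g \<le> enat N"
    if "\<And>H. local_generator n l H \<Longrightarrow> gate (mat_exp (\<i> \<cdot>\<^sub>m H))" for gate
    unfolding circuit_complexity_def using Hs that
    by (intro INF_lower2[of "map (\<lambda>H. mat_exp (\<i> \<cdot>\<^sub>m H)) Hs"]) auto
  show "qubit_circuit_complexity l n g \<le> enat N" "fermionic_circuit_complexity l n g \<le> enat N"
    unfolding qubit_circuit_complexity_def fermionic_circuit_complexity_def
    by (intro * local_generator_qubit_gate local_generator_majorana_gate; assumption)+
qed

section \<open>Conjugation by unitaries and real linear combinations\<close>

definition conj_by :: "complex mat \<Rightarrow> complex mat \<Rightarrow> complex mat" where
  "conj_by U A = mat_adjoint U * A * U"

lemma conj_by_carrier [simp]: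
  "U \<in> carrier_mat d d \<Longrightarrow> A \<in> carrier_mat d d \<Longrightarrow> conj_by U A \<in> carrier_mat d d"
  unfolding conj_by_def by simp

text \<open>The order reverses: a factor appended on the right acts last. Hence eliminations extend
  their circuits on the right.\<close>

lemma conj_by_comp:
  assumes "U \<in> carrier_mat d d" "V \<in> carrier_mat d d" "A \<in> carrier_mat d d"
  shows "conj_by (U * V) A = conj_by V (conj_by U A)"
  using assms unfolding conj_by_def
  by (simp add: mat_adjoint_mult[of _ d] assoc_mult_mat[of _ d d _ d _ d])

lemma conj_by_mult:
  assumes U: "unitary_mat d U" and "A \<in> carrier_mat d d" "B \<in> carrier_mat d d"
  shows "conj_by U (A * B) = conj_by U A * conj_by U B"
proof -
  have "conj_by U A * conj_by U B = mat_adjoint U * A * (U * mat_adjoint U) * B * U"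
    using assms(2,3) unitary_matD(1,2)[OF U] unfolding conj_by_def
    by (simp add: assoc_mult_mat[of _ d d _ d _ d])
  then show ?thesis
    using assms(2,3) unitary_matD[OF U] unfolding conj_by_def
    by (simp add: assoc_mult_mat[of _ d d _ d _ d])
qed

lemma conj_by_smult:
  assumes "U \<in> carrier_mat d d" "A \<in> carrier_mat d d"
  shows "conj_by U (c \<cdot>\<^sub>m A) = c \<cdot>\<^sub>m conj_by U A"
  using assms unfolding conj_by_def
  by (simp add: mult_smult_distrib[of _ d d _ d] mult_smult_assoc_mat[of _ d d _ d])

lemma conj_by_add:
  assumes "U \<in> carrier_mat d d" "A \<in> carrier_mat d d" "B \<in> carrier_mat d d"
  shows "conj_by U (A + B) = conj_by U A + conj_by U B"
  using assms unfolding conj_by_def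
  by (simp add: add_mult_distrib_mat[of _ d d _ _ d] mult_add_distrib_mat[of _ d d _ d])

lemma conj_by_one [simp]:
  assumes "unitary_mat d U"
  shows "conj_by U (1\<^sub>m d) = 1\<^sub>m d"
  using unitary_matD[OF assms] unfolding conj_by_def by simp

lemma conj_by_id [simp]: "A \<in> carrier_mat d d \<Longrightarrow> conj_by (1\<^sub>m d) A = A"
  unfolding conj_by_def by simp

lemma conj_by_commuting:
  assumes U: "unitary_mat d U" and A: "A \<in> carrier_mat d d" "A * U = U * A"
  shows "conj_by U A = A"
proof -
  have "conj_by U A = mat_adjoint U * (A * U)"
    using unitary_matD(1,2)[OF U] A unfolding conj_by_def by (simp add: assoc_mult_mat[of _ d d _ d _ d])
  also have "\<dots> = (mat_adjoint U * U) * A"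
    using unitary_matD(1,2)[OF U] A by (simp add: assoc_mult_mat[of _ d d _ d _ d])
  finally show ?thesis using unitary_matD[OF U] A by simp
qed

lemma conj_by_eq_imp_commuting:
  assumes U: "unitary_mat d U" and A: "A \<in> carrier_mat d d" "conj_by U A = A"
  shows "A * U = U * A"
proof -
  have "U * A = U * conj_by U A" using A by simp
  also have "\<dots> = (U * mat_adjoint U) * (A * U)"
    using unitary_matD(1,2)[OF U] A(1) unfolding conj_by_def by (simp add: assoc_mult_mat[of _ d d _ d _ d])
  finally show ?thesis using unitary_matD[OF U] A by simp
qed

lemma conj_by_exp:
  assumes U: "unitary_mat d U" and A: "A \<in> carrier_mat d d"
  shows "conj_by U (mat_exp A) = mat_exp (conj_by U A)"
  using mat_exp_conj[OF A unitary_matD(2,1,4,3)[OF U]] unfolding conj_by_def by simp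

lemma conj_by_hermitian:
  assumes "U \<in> carrier_mat d d" "hermitian_mat d H"
  shows "hermitian_mat d (conj_by U H)"
  using assms unfolding hermitian_mat_def conj_by_def
  by (auto simp: mat_adjoint_mult[of _ d] assoc_mult_mat[of _ d d _ d _ d])

lemma conj_by_adjoint_inverse:
  assumes U: "unitary_mat d U" and A: "A \<in> carrier_mat d d"
  shows "U * conj_by U A * mat_adjoint U = A"
proof -
  have "U * conj_by U A * mat_adjoint U = (U * mat_adjoint U) * A * (U * mat_adjoint U)"
    using unitary_matD(1,2)[OF U] A unfolding conj_by_def by (simp add: assoc_mult_mat[of _ d d _ d _ d])
  then show ?thesis using unitary_matD[OF U] A by simp
qed

text \<open>Entrywise, to match the sum in \<open>gaussian_unitary\<close>. The index set is
  arbitrary so that combinations of images, and not only of Majorana operators, can be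
  formed.\<close>

definition mat_lincomb :: "nat \<Rightarrow> 'i set \<Rightarrow> ('i \<Rightarrow> real) \<Rightarrow> ('i \<Rightarrow> complex mat) \<Rightarrow> complex mat" where
  "mat_lincomb d I v B = mat d d (\<lambda>(i, j). \<Sum>\<nu>\<in>I. complex_of_real (v \<nu>) * B \<nu> $$ (i, j))"

lemma mat_lincomb_carrier [simp]: "mat_lincomb d I v B \<in> carrier_mat d d"
  unfolding mat_lincomb_def by simp

lemma mat_lincomb_mult_right:
  assumes "\<And>\<nu>. \<nu> \<in> I \<Longrightarrow> B \<nu> \<in> carrier_mat d d" "A \<in> carrier_mat d d"
  shows "mat_lincomb d I v B * A = mat_lincomb d I v (\<lambda>\<nu>. B \<nu> * A)"
proof (rule square_mat_eqI[of _ d])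
  fix i j assume ij: "i < d" "j < d"
  have "(mat_lincomb d I v B * A) $$ (i, j) = (\<Sum>l<d. (\<Sum>\<nu>\<in>I. complex_of_real (v \<nu>) * B \<nu> $$ (i, l)) * A $$ (l, j))"
    using ij assms by (subst mult_mat_entry[of _ d]) (auto simp: mat_lincomb_def)
  also have "\<dots> = (\<Sum>\<nu>\<in>I. \<Sum>l<d. complex_of_real (v \<nu>) * B \<nu> $$ (i, l) * A $$ (l, j))"
    unfolding sum_distrib_right by (rule sum.swap)
  also have "\<dots> = (\<Sum>\<nu>\<in>I. complex_of_real (v \<nu>) * (B \<nu> * A) $$ (i, j))"
  proof (rule sum.cong[OF refl])
    fix \<nu> assume "\<nu> \<in> I"
    then show "(\<Sum>l<d. complex_of_real (v \<nu>) * B \<nu> $$ (i, l) * A $$ (l, j)) = complex_of_real (v \<nu>) * (B \<nu> * A) $$ (i, j)"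
      using ij assms by (subst mult_mat_entry[of _ d]) (auto simp: sum_distrib_left mult.assoc)
  qed
  finally show "(mat_lincomb d I v B * A) $$ (i, j) = mat_lincomb d I v (\<lambda>\<nu>. B \<nu> * A) $$ (i, j)"
    using ij unfolding mat_lincomb_def by simp
qed (use assms in auto)

lemma mat_lincomb_mult_left:
  assumes "\<And>\<nu>. \<nu> \<in> I \<Longrightarrow> B \<nu> \<in> carrier_mat d d" "A \<in> carrier_mat d d"
  shows "A * mat_lincomb d I v B = mat_lincomb d I v (\<lambda>\<nu>. A * B \<nu>)"
proof (rule square_mat_eqI[of _ d])
  fix i j assume ij: "i < d" "j < d"
  have "(A * mat_lincomb d I v B) $$ (i, j) = (\<Sum>l<d. A $$ (i, l) * (\<Sum>\<nu>\<in>I. complex_of_real (v \<nu>) * B \<nu> $$ (l, j)))"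
    using ij assms by (subst mult_mat_entry[of _ d]) (auto simp: mat_lincomb_def)
  also have "\<dots> = (\<Sum>\<nu>\<in>I. \<Sum>l<d. A $$ (i, l) * (complex_of_real (v \<nu>) * B \<nu> $$ (l, j)))"
    unfolding sum_distrib_left by (rule sum.swap)
  also have "\<dots> = (\<Sum>\<nu>\<in>I. complex_of_real (v \<nu>) * (A * B \<nu>) $$ (i, j))"
  proof (rule sum.cong[OF refl])
    fix \<nu> assume "\<nu> \<in> I"
    then show "(\<Sum>l<d. A $$ (i, l) * (complex_of_real (v \<nu>) * B \<nu> $$ (l, j))) = complex_of_real (v \<nu>) * (A * B \<nu>) $$ (i, j)"
      using ij assms by (subst mult_mat_entry[of _ d]) (auto simp: sum_distrib_left mult_ac)
  qed
  finally show "(A * mat_lincomb d I v B) $$ (i, j) = mat_lincomb d I v (\<lambda>\<nu>. A * B \<nu>) $$ (i, j)"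
    using ij unfolding mat_lincomb_def by simp
qed (use assms in auto)

lemma conj_by_lincomb:
  assumes "\<And>\<nu>. \<nu> \<in> I \<Longrightarrow> B \<nu> \<in> carrier_mat d d" "U \<in> carrier_mat d d"
  shows "conj_by U (mat_lincomb d I v B) = mat_lincomb d I v (\<lambda>\<nu>. conj_by U (B \<nu>))"
  using assms unfolding conj_by_def by (simp add: mat_lincomb_mult_left mat_lincomb_mult_right)

lemma mat_lincomb_add:
  assumes "\<And>\<nu>. \<nu> \<in> I \<Longrightarrow> B \<nu> \<in> carrier_mat d d" "\<And>\<nu>. \<nu> \<in> I \<Longrightarrow> C \<nu> \<in> carrier_mat d d"
  shows "mat_lincomb d I v B + mat_lincomb d I v C = mat_lincomb d I v (\<lambda>\<nu>. B \<nu> + C \<nu>)"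
proof (rule square_mat_eqI[of _ d])
  fix i j assume ij: "i < d" "j < d"
  have "(\<Sum>\<nu>\<in>I. complex_of_real (v \<nu>) * (B \<nu> + C \<nu>) $$ (i, j)) =
      (\<Sum>\<nu>\<in>I. complex_of_real (v \<nu>) * B \<nu> $$ (i, j) + complex_of_real (v \<nu>) * C \<nu> $$ (i, j))"
  proof (rule sum.cong[OF refl])
    fix \<nu> assume "\<nu> \<in> I"
    then show "complex_of_real (v \<nu>) * (B \<nu> + C \<nu>) $$ (i, j) =
        complex_of_real (v \<nu>) * B \<nu> $$ (i, j) + complex_of_real (v \<nu>) * C \<nu> $$ (i, j)"
      using assms(2)[of \<nu>] ij by (auto simp: distrib_left)
  qed
  then show "(mat_lincomb d I v B + mat_lincomb d I v C) $$ (i, j) = mat_lincomb d I v (\<lambda>\<nu>. B \<nu> + C \<nu>) $$ (i, j)"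
    using ij by (simp add: mat_lincomb_def sum.distrib)
qed simp_all

subsection \<open>Rotations of adjacent Majorana operators\<close>

abbreviation majorana_sum :: "nat \<Rightarrow> (nat \<Rightarrow> real) \<Rightarrow> complex mat" where
  "majorana_sum n v \<equiv> mat_lincomb (2 ^ n) {1..2 * n} v (majorana n)"

definition majorana_linear :: "nat \<Rightarrow> complex mat \<Rightarrow> bool" where
  "majorana_linear n A \<longleftrightarrow> (\<exists>v. A = majorana_sum n v)"

lemma one_smult_mat [simp]: "(1 :: 'a :: monoid_mult) \<cdot>\<^sub>m A = A"
  by (rule eq_matI) auto

lemma majorana_linear_lincomb:
  assumes "\<And>\<nu>. \<nu> \<in> I \<Longrightarrow> majorana_linear n (B \<nu>)"
  shows "majorana_linear n (mat_lincomb (2 ^ n) I v B)"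
proof -
  obtain w where w: "\<And>\<nu>. \<nu> \<in> I \<Longrightarrow> B \<nu> = majorana_sum n (w \<nu>)"
    using assms unfolding majorana_linear_def by metis
  have "mat_lincomb (2 ^ n) I v B = majorana_sum n (\<lambda>\<mu>. \<Sum>\<nu>\<in>I. v \<nu> * w \<nu> \<mu>)"
  proof (rule square_mat_eqI[of _ "2 ^ n"])
    fix i j :: nat assume ij: "i < 2 ^ n" "j < 2 ^ n"
    have "(\<Sum>\<nu>\<in>I. complex_of_real (v \<nu>) * B \<nu> $$ (i, j)) =
      (\<Sum>\<nu>\<in>I. \<Sum>\<mu>\<in>{1..2 * n}. complex_of_real (v \<nu>) * (complex_of_real (w \<nu> \<mu>) * majorana n \<mu> $$ (i, j)))"
      using ij by (intro sum.cong refl) (simp add: w mat_lincomb_def sum_distrib_left)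
    also have "\<dots> = (\<Sum>\<mu>\<in>{1..2 * n}. complex_of_real (\<Sum>\<nu>\<in>I. v \<nu> * w \<nu> \<mu>) * majorana n \<mu> $$ (i, j))"
      by (subst sum.swap) (simp add: sum_distrib_right mult.assoc)
    finally show "mat_lincomb (2 ^ n) I v B $$ (i, j) = majorana_sum n (\<lambda>\<mu>. \<Sum>\<nu>\<in>I. v \<nu> * w \<nu> \<mu>) $$ (i, j)"
      using ij by (simp add: mat_lincomb_def)
  qed simp_all
  then show ?thesis unfolding majorana_linear_def by blast
qed

lemma majorana_linear_majorana [simp]:
  assumes "\<mu> \<in> {1..2 * n}"
  shows "majorana_linear n (majorana n \<mu>)"
proof -
  have "majorana n \<mu> = majorana_sum n (\<lambda>\<nu>. if \<nu> = \<mu> then 1 else 0)"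
  proof (rule square_mat_eqI[of _ "2 ^ n"])
    fix i j :: nat assume ij: "i < 2 ^ n" "j < 2 ^ n"
    have "majorana_sum n (\<lambda>\<nu>. if \<nu> = \<mu> then 1 else 0) $$ (i, j) =
        (\<Sum>\<nu>\<in>{1..2 * n}. complex_of_real (if \<nu> = \<mu> then 1 else 0) * majorana n \<nu> $$ (i, j))"
      using ij unfolding mat_lincomb_def by simp
    also have "\<dots> = (\<Sum>\<nu>\<in>{1..2 * n}. if \<nu> = \<mu> then majorana n \<nu> $$ (i, j) else 0)"
      by (rule sum.cong) simp_all
    finally show "majorana n \<mu> $$ (i, j) = majorana_sum n (\<lambda>\<nu>. if \<nu> = \<mu> then 1 else 0) $$ (i, j)"
      using assms by simp
  qed (use assms in auto)
  then show ?thesis unfolding majorana_linear_def by blast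
qed

lemma majorana_linear_comb2:
  assumes "majorana_linear n A" "majorana_linear n B"
  shows "majorana_linear n (complex_of_real x \<cdot>\<^sub>m A + complex_of_real y \<cdot>\<^sub>m B)"
proof -
  have c: "A \<in> carrier_mat (2 ^ n) (2 ^ n)" "B \<in> carrier_mat (2 ^ n) (2 ^ n)"
    using assms unfolding majorana_linear_def by auto
  have "complex_of_real x \<cdot>\<^sub>m A + complex_of_real y \<cdot>\<^sub>m B =
      mat_lincomb (2 ^ n) (UNIV :: bool set) (\<lambda>b. if b then x else y) (\<lambda>b. if b then A else B)"
    using c by (intro square_mat_eqI[of _ "2 ^ n"]) (auto simp: mat_lincomb_def UNIV_bool)
  then show ?thesis using majorana_linear_lincomb[of "UNIV :: bool set" n "\<lambda>b. if b then A else B"] assms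
    by simp
qed

text \<open>Closure under products is then mere linear substitution. Orthonormality of the
  coefficient rows is recovered, where used, from the squares and anticommutators that conjugation
  by a unitary preserves.\<close>

definition linear_gaussian :: "nat \<Rightarrow> complex mat \<Rightarrow> bool" where
  "linear_gaussian n F \<longleftrightarrow> unitary_mat (2 ^ n) F \<and>
     (\<forall>\<mu>\<in>{1..2 * n}. majorana_linear n (conj_by F (majorana n \<mu>)))"

lemma linear_gaussianD:
  assumes "linear_gaussian n F"
  shows "unitary_mat (2 ^ n) F" "F \<in> carrier_mat (2 ^ n) (2 ^ n)"
    "\<mu> \<in> {1..2 * n} \<Longrightarrow> majorana_linear n (conj_by F (majorana n \<mu>))"
  using assms unitary_matD(1) unfolding linear_gaussian_def by blast+

lemma gaussian_unitary_linear:
  assumes "gaussian_unitary n G"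
  shows "linear_gaussian n G"
proof -
  obtain Q where Q: "\<forall>\<mu>\<in>{1..2 * n}. mat_adjoint G * majorana n \<mu> * G =
      mat (2 ^ n) (2 ^ n) (\<lambda>(i, j). \<Sum>\<nu>=1..2 * n.
        complex_of_real (Q $$ (\<mu> - 1, \<nu> - 1)) * majorana n \<nu> $$ (i, j))" and "unitary_mat (2 ^ n) G"
    using assms unfolding gaussian_unitary_def by blast
  moreover have "majorana_linear n (conj_by G (majorana n \<mu>))" if "\<mu> \<in> {1..2 * n}" for \<mu>
    using Q that unfolding majorana_linear_def conj_by_def mat_lincomb_def
    by (intro exI[of _ "\<lambda>\<nu>. Q $$ (\<mu> - 1, \<nu> - 1)"]) simp
  ultimately show ?thesis unfolding linear_gaussian_def by blast
qed

lemma linear_gaussian_one: "linear_gaussian n (1\<^sub>m (2 ^ n))"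
  unfolding linear_gaussian_def by simp

lemma linear_gaussian_mult:
  assumes F: "linear_gaussian n F" and G: "linear_gaussian n G"
  shows "linear_gaussian n (F * G)"
  unfolding linear_gaussian_def
proof (intro conjI ballI)
  note f = linear_gaussianD[OF F] and g = linear_gaussianD[OF G]
  show "unitary_mat (2 ^ n) (F * G)" using f(1) g(1) by (rule unitary_mat_mult)
  fix \<mu> assume m: "\<mu> \<in> {1..2 * n}"
  obtain v where v: "conj_by F (majorana n \<mu>) = majorana_sum n v"
    using f(3)[OF m] unfolding majorana_linear_def by blast
  have "conj_by (F * G) (majorana n \<mu>) = conj_by G (majorana_sum n v)"
    using f(2) g(2) m by (simp add: conj_by_comp[of _ "2 ^ n"] v)
  also have "\<dots> = mat_lincomb (2 ^ n) {1..2 * n} v (\<lambda>\<nu>. conj_by G (majorana n \<nu>))"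
    using g(2) by (intro conj_by_lincomb) auto
  finally show "majorana_linear n (conj_by (F * G) (majorana n \<mu>))"
    using majorana_linear_lincomb[of "{1..2 * n}" n, OF g(3)] by simp
qed

section \<open>A single local rotation gate\<close>

text \<open>Since K anticommutes with A, moving A to the left turns the conjugate into
  \<open>A * (c + s K) ^ 2\<close>, and K squared acts as -1 on A and B, so the angle doubles.
  Stating the relations abstractly lets the lemma apply to the pair (A, B) and again to (B,
  -A).\<close>

lemma conj_by_rotation:
  fixes c s :: real
  assumes carr: "A \<in> carrier_mat d d" "B \<in> carrier_mat d d" "K \<in> carrier_mat d d"
    and adj: "mat_adjoint K = - 1 \<cdot>\<^sub>m K"
    and rel: "A * K = B" "K * A = - 1 \<cdot>\<^sub>m B" "B * K = - 1 \<cdot>\<^sub>m A"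
  shows "conj_by (of_real c \<cdot>\<^sub>m 1\<^sub>m d + of_real s \<cdot>\<^sub>m K) A =
    of_real (c\<^sup>2 - s\<^sup>2) \<cdot>\<^sub>m A + of_real (2 * c * s) \<cdot>\<^sub>m B"
proof -
  let ?c = "complex_of_real c" and ?s = "complex_of_real s"
  have "mat_adjoint (?c \<cdot>\<^sub>m 1\<^sub>m d + ?s \<cdot>\<^sub>m K) = ?c \<cdot>\<^sub>m 1\<^sub>m d + (- ?s) \<cdot>\<^sub>m K"
  proof (rule square_mat_eqI[of _ d])
    fix i j assume ij: "i < d" "j < d"
    have "mat_adjoint K $$ (i, j) = (- 1 \<cdot>\<^sub>m K) $$ (i, j)" unfolding adj ..
    then have "cnj (K $$ (j, i)) = - K $$ (i, j)" using ij carr by simp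
    then show "mat_adjoint (?c \<cdot>\<^sub>m 1\<^sub>m d + ?s \<cdot>\<^sub>m K) $$ (i, j) = (?c \<cdot>\<^sub>m 1\<^sub>m d + (- ?s) \<cdot>\<^sub>m K) $$ (i, j)"
      using ij carr by auto
  qed (use carr in auto)
  then have "conj_by (?c \<cdot>\<^sub>m 1\<^sub>m d + ?s \<cdot>\<^sub>m K) A = (?c \<cdot>\<^sub>m 1\<^sub>m d + (- ?s) \<cdot>\<^sub>m K) * A * (?c \<cdot>\<^sub>m 1\<^sub>m d + ?s \<cdot>\<^sub>m K)"
    unfolding conj_by_def by simp
  also have "(?c \<cdot>\<^sub>m 1\<^sub>m d + (- ?s) \<cdot>\<^sub>m K) * A = ?c \<cdot>\<^sub>m A + ?s \<cdot>\<^sub>m B"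
    using carr
    by (simp add: add_mult_distrib_mat[of _ d d _ _ d] mult_smult_assoc_mat[of _ d d _ d] rel smult_smult_mat)
  also have "(?c \<cdot>\<^sub>m A + ?s \<cdot>\<^sub>m B) * (?c \<cdot>\<^sub>m 1\<^sub>m d + ?s \<cdot>\<^sub>m K) =
      ?c \<cdot>\<^sub>m (?c \<cdot>\<^sub>m A + ?s \<cdot>\<^sub>m B) + ?s \<cdot>\<^sub>m (?c \<cdot>\<^sub>m B + ?s \<cdot>\<^sub>m (- 1 \<cdot>\<^sub>m A))"
  proof -
    have "(?c \<cdot>\<^sub>m A + ?s \<cdot>\<^sub>m B) * K = ?c \<cdot>\<^sub>m B + ?s \<cdot>\<^sub>m (- 1 \<cdot>\<^sub>m A)"
      using carr by (simp add: add_mult_distrib_mat[of _ d d _ _ d] mult_smult_assoc_mat[of _ d d _ d] rel)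
    moreover have "(?c \<cdot>\<^sub>m A + ?s \<cdot>\<^sub>m B) * 1\<^sub>m d = ?c \<cdot>\<^sub>m A + ?s \<cdot>\<^sub>m B"
      using carr by simp
    ultimately show ?thesis
      using carr by (simp only: mult_add_distrib_mat[of _ d d _ d] mult_smult_distrib[of _ d d _ d]
          add_carrier_mat smult_carrier_mat one_carrier_mat)
  qed
  also have "\<dots> = of_real (c\<^sup>2 - s\<^sup>2) \<cdot>\<^sub>m A + of_real (2 * c * s) \<cdot>\<^sub>m B"
    using carr by (intro square_mat_eqI[of _ d]) (auto simp: algebra_simps power2_eq_square)
  finally show ?thesis .
qed

text \<open>Here the strings cancel: as l is k or k + 1, any third qubit is crossed by both strings
  or by neither, and the two signs multiply to 1. For odd a both operators sit on the same qubit,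
  hence \<open>remdups\<close>.\<close>

lemma supported_on_majorana_pair:
  assumes a: "a \<in> {1..2 * n}" "Suc a \<in> {1..2 * n}" "k = (a + 1) div 2" "l = (a + 2) div 2"
  shows "supported_on n (remdups [k, l]) (majorana n a * majorana n (Suc a))"
proof -
  have k: "k \<in> {1..n}" and l: "l \<in> {1..n}" "l = k \<or> l = Suc k"
    using a majorana_qubit_in_range[OF a(1)] majorana_qubit_in_range[OF a(2)] by auto
  have eq: "majorana n a * majorana n (Suc a) = monomial_mat (2 ^ n) (\<lambda>i. flip_bit (n - l) (flip_bit (n - k) i))
     (\<lambda>i. majorana_coeff n a i * majorana_coeff n (Suc a) (flip_bit (n - k) i))"
    using majorana_monomial[OF a(1)] majorana_monomial[OF a(2)] a(3,4) qubit_flip_less[OF k]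
    by (simp add: monomial_mat_mult)
  show ?thesis unfolding eq
  proof (rule supported_on_monomial)
    show "flip_bit (n - l) (flip_bit (n - k) i) < 2 ^ n" if "i < 2 ^ n" for i :: nat
      using that by (intro qubit_flip_less k l)
    fix j i assume j: "j \<in> {1..n} - set (remdups [k, l])"
    then have j1: "j \<in> {1..n}" and jk: "j \<noteq> k" "j \<noteq> l" unfolding set_remdups by simp_all
    have kl: "(a + 1) div 2 = k" "(Suc a + 1) div 2 = l" using a by auto
    have lt: "j < l \<longleftrightarrow> j < k" using jk l by auto
    have "majorana_coeff n (Suc a) (flip_bit (n - k) (flip_bit (n - j) i)) =
       (if j < k then - majorana_coeff n (Suc a) (flip_bit (n - k) i) else majorana_coeff n (Suc a) (flip_bit (n - k) i))"
      using majorana_coeff_flip[OF a(2) j1, of "flip_bit (n - k) i"] jk lt unfolding kl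
      by (simp add: flip_bit_commute[of "n - k"])
    moreover have "majorana_coeff n a (flip_bit (n - j) i) = (if j < k then - majorana_coeff n a i else majorana_coeff n a i)"
      using majorana_coeff_flip[OF a(1) j1, of i] jk unfolding kl by simp
    moreover have "n - k \<noteq> n - j" "n - l \<noteq> n - j" using j1 jk k l by auto
    ultimately show "flip_bit (n - l) (flip_bit (n - k) (flip_bit (n - j) i)) = flip_bit (n - j) (flip_bit (n - l) (flip_bit (n - k) i)) \<and>
      majorana_coeff n a (flip_bit (n - j) i) * majorana_coeff n (Suc a) (flip_bit (n - k) (flip_bit (n - j) i)) =
      majorana_coeff n a i * majorana_coeff n (Suc a) (flip_bit (n - k) i) \<and>
      bit (flip_bit (n - l) (flip_bit (n - k) i)) (n - j) = bit i (n - j)"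
      by (auto simp: bit_flip_bit_nat flip_bit_commute)
  qed
qed

text \<open>A string reaches only towards lower qubits, so it stays within any initial block
  containing the qubit of \<open>\<mu>\<close>.\<close>

lemma supported_on_majorana:
  assumes mu: "\<mu> \<in> {1..2 * n}" "\<mu> \<le> 2 * m"
  shows "supported_on n [1..<Suc m] (majorana n \<mu>)"
proof -
  let ?k = "(\<mu> + 1) div 2"
  have k: "?k \<in> {1..n}" "?k \<le> m" using mu majorana_qubit_in_range[OF mu(1)] by auto
  show ?thesis unfolding majorana_monomial[OF mu(1)]
  proof (rule supported_on_monomial)
    show "flip_bit (n - ?k) i < 2 ^ n" if "i < 2 ^ n" for i :: nat
      using that by (intro qubit_flip_less k)
    fix j i assume "j \<in> {1..n} - set [1..<Suc m]"
    then have j: "j \<in> {1..n}" "?k < j" using k(2) by auto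
    then have "n - ?k \<noteq> n - j" by auto
    moreover have "majorana_coeff n \<mu> (flip_bit (n - j) i) = majorana_coeff n \<mu> i"
      using j(2) unfolding majorana_coeff_flip[OF mu(1) j(1)] by auto
    ultimately show "flip_bit (n - ?k) (flip_bit (n - j) i) = flip_bit (n - j) (flip_bit (n - ?k) i) \<and>
      majorana_coeff n \<mu> (flip_bit (n - j) i) = majorana_coeff n \<mu> i \<and>
      bit (flip_bit (n - ?k) i) (n - j) = bit i (n - j)"
      by (auto simp: bit_flip_bit_nat flip_bit_commute)
  qed
qed

lemma generated_algebra_carrier:
  assumes "A \<in> generated_algebra d S" "S \<subseteq> carrier_mat d d"
  shows "A \<in> carrier_mat d d"
  using assms by induction auto

text \<open>The generator is proportional to P, \<open>- \<i>\<close> times the product K of the two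
  operators; the factor makes the anti-Hermitian K Hermitian, with square 1. Any third Majorana
  operator anticommutes with both factors, hence commutes with K and is fixed.\<close>

lemma majorana_rotation:
  assumes l: "2 \<le> l" and a: "a \<in> {1..2 * n}" "Suc a \<in> {1..2 * n}"
  shows "\<exists>g. circuit n l 1 g \<and>
    conj_by g (majorana n a) = of_real (cos x) \<cdot>\<^sub>m majorana n a + of_real (sin x) \<cdot>\<^sub>m majorana n (Suc a) \<and>
    conj_by g (majorana n (Suc a)) = of_real (- sin x) \<cdot>\<^sub>m majorana n a + of_real (cos x) \<cdot>\<^sub>m majorana n (Suc a) \<and>
    (\<forall>\<mu>\<in>{1..2 * n} - {a, Suc a}. conj_by g (majorana n \<mu>) = majorana n \<mu>)"
proof -
  define d :: nat where "d = 2 ^ n"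
  define A where "A = majorana n a"
  define B where "B = majorana n (Suc a)"
  define K where "K = A * B"
  have A: "A \<in> carrier_mat d d" "A * A = 1\<^sub>m d" "mat_adjoint A = A"
    and B: "B \<in> carrier_mat d d" "B * B = 1\<^sub>m d" "mat_adjoint B = B"
    using a unfolding A_def B_def d_def by simp_all
  have K: "K \<in> carrier_mat d d" using A B unfolding K_def by simp
  have BA: "B * A = - 1 \<cdot>\<^sub>m K"
    using majorana_anticommute[OF a(2,1)] unfolding K_def A_def B_def by simp
  note assoc = assoc_mult_mat[of _ d d _ d _ d]
  have AK: "A * K = B" and KB: "K * B = A"
    using A B unfolding K_def by (simp_all add: assoc[symmetric])
  have BK: "B * K = - 1 \<cdot>\<^sub>m A"
  proof -
    have "B * K = (B * A) * B" using A(1) B(1) unfolding K_def by (simp add: assoc)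
    then show ?thesis unfolding BA using K B(1) KB by (simp add: mult_smult_assoc_mat[of _ d d _ d])
  qed
  have KA: "K * A = - 1 \<cdot>\<^sub>m B"
  proof -
    have "K * A = A * (B * A)" using A(1) B(1) unfolding K_def by (simp add: assoc)
    then show ?thesis unfolding BA using K A(1) AK by (simp add: mult_smult_distrib[of _ d d _ d])
  qed
  have Kadj: "mat_adjoint K = - 1 \<cdot>\<^sub>m K"
    using A B BA unfolding K_def by (simp add: mat_adjoint_mult[of _ d])
  have KK: "K * K = - 1 \<cdot>\<^sub>m 1\<^sub>m d"
  proof -
    have "K * K = A * (B * K)" using A(1) B(1) K unfolding K_def by (simp add: assoc)
    then show ?thesis unfolding BK using A by (simp add: mult_smult_distrib[of _ d d _ d])
  qed
  define P where "P = - \<i> \<cdot>\<^sub>m K"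
  have P: "P \<in> carrier_mat d d" using K unfolding P_def by simp
  have PP: "P * P = 1\<^sub>m d"
    using K KK unfolding P_def
    by (simp add: mult_smult_assoc_mat[of _ d d _ d] mult_smult_distrib[of _ d d _ d] smult_smult_mat)
  have "hermitian_mat d P"
    using P unfolding hermitian_mat_def P_def by (simp add: mat_adjoint_smult Kadj smult_smult_mat)
  moreover have "P \<in> generated_algebra d (majorana n ` {a, Suc a})"
    unfolding P_def K_def A_def B_def by (intro generated_algebra.smult generated_algebra.mult generated_algebra.gen) auto
  moreover have "set (remdups [(a + 1) div 2, (a + 2) div 2]) \<subseteq> {1..n}"
    using majorana_qubit_in_range[OF a(1)] majorana_qubit_in_range[OF a(2)] by simp
  moreover have "length (remdups [(a + 1) div 2, (a + 2) div 2]) \<le> l"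
    using l by (intro order_trans[OF length_remdups_leq]) simp
  moreover have "supported_on n (remdups [(a + 1) div 2, (a + 2) div 2]) P"
    using supported_on_smult[OF supported_on_majorana_pair[OF a refl refl]] unfolding P_def K_def A_def B_def by blast
  ultimately have gen: "local_generator n l P"
    using a l unfolding d_def by (intro local_generatorI[of _ _ "{a, Suc a}"]) auto
  \<comment> \<open>Half the angle, because conjugation applies the gate from both sides.\<close>
  define c where "c = cos (x / 2)"
  define s where "s = sin (x / 2)"
  define g where "g = mat_exp (\<i> \<cdot>\<^sub>m (of_real (x / 2) \<cdot>\<^sub>m P))"
  have circ: "circuit n l 1 g"
    unfolding g_def by (intro circuit_gate local_generator_smult_real gen)
  have "\<i> * complex_of_real s * - \<i> = of_real s" by (simp add: complex_eq_iff)
  then have g: "g = of_real c \<cdot>\<^sub>m 1\<^sub>m d + of_real s \<cdot>\<^sub>m K"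
    unfolding g_def mat_exp_involution[OF P PP] c_def s_def unfolding P_def
    by (simp only: smult_smult_mat)
  have cs: "c\<^sup>2 - s\<^sup>2 = cos x" "2 * c * s = sin x"
    using cos_double[of "x / 2"] sin_double[of "x / 2"] unfolding c_def s_def by auto
  have "conj_by g A = of_real (cos x) \<cdot>\<^sub>m A + of_real (sin x) \<cdot>\<^sub>m B"
    unfolding g conj_by_rotation[OF A(1) B(1) K Kadj AK KA BK] cs ..
  moreover have "conj_by g B = of_real (cos x) \<cdot>\<^sub>m B + of_real (sin x) \<cdot>\<^sub>m (- 1 \<cdot>\<^sub>m A)"
  proof -
    have "K * B = - 1 \<cdot>\<^sub>m (- 1 \<cdot>\<^sub>m A)" using KB A(1) by (simp add: smult_smult_mat)
    moreover have "- 1 \<cdot>\<^sub>m A * K = - 1 \<cdot>\<^sub>m B" using A(1) K AK by (simp add: mult_smult_assoc_mat[of _ d d _ d])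
    moreover have "- 1 \<cdot>\<^sub>m A \<in> carrier_mat d d" using A(1) by simp
    ultimately show ?thesis
      unfolding g cs[symmetric] by (intro conj_by_rotation B(1) K Kadj BK)
  qed
  then have "conj_by g B = of_real (- sin x) \<cdot>\<^sub>m A + of_real (cos x) \<cdot>\<^sub>m B"
    using A(1) B(1) by (auto intro!: eq_matI)
  moreover have "conj_by g (majorana n \<mu>) = majorana n \<mu>" if m: "\<mu> \<in> {1..2 * n} - {a, Suc a}" for \<mu>
  proof -
    let ?M = "majorana n \<mu>"
    have M: "?M \<in> carrier_mat d d" using m unfolding d_def by simp
    have MA: "?M * A = - 1 \<cdot>\<^sub>m (A * ?M)" and MB: "?M * B = - 1 \<cdot>\<^sub>m (B * ?M)"
      unfolding A_def B_def using m a by (auto intro!: majorana_anticommute)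
    have "?M * K = (?M * A) * B" using A(1) B(1) M unfolding K_def by (simp add: assoc)
    also have "\<dots> = - 1 \<cdot>\<^sub>m (A * (?M * B))"
      unfolding MA using A(1) B(1) M by (simp add: mult_smult_assoc_mat[of _ d d _ d] assoc)
    also have "\<dots> = K * ?M"
      unfolding MB using A(1) B(1) M unfolding K_def
      by (simp add: mult_smult_distrib[of _ d d _ d] smult_smult_mat assoc)
    finally have MK: "?M * K = K * ?M" .
    have "?M * g = g * ?M"
      unfolding g using M K
      by (simp add: add_mult_distrib_mat[of _ d d _ _ d] mult_add_distrib_mat[of _ d d _ d]
          mult_smult_assoc_mat[of _ d d _ d] mult_smult_distrib[of _ d d _ d] MK)
    then show ?thesis using conj_by_commuting[OF circuit_unitary[OF circ]] M unfolding d_def by blast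
  qed
  ultimately show ?thesis using circ unfolding A_def B_def by blast
qed

section \<open>Sweeping a coefficient vector onto one axis\<close>

text \<open>x is minus the polar angle of (p, q). Choosing the nonnegative root fixes the sign of
  the surviving coefficient.\<close>

lemma rotation_angle_exists:
  fixes p q :: real
  shows "\<exists>x. p * cos x - q * sin x = sqrt (p\<^sup>2 + q\<^sup>2) \<and> p * sin x + q * cos x = 0"
proof (cases "p\<^sup>2 + q\<^sup>2 = 0")
  case True
  then have "p = 0" "q = 0" by (simp_all add: sum_power2_eq_zero_iff)
  then show ?thesis by simp
next
  case False
  define r where "r = sqrt (p\<^sup>2 + q\<^sup>2)"
  have pos: "0 < p\<^sup>2 + q\<^sup>2" using False by (metis less_eq_real_def sum_power2_ge_zero)
  then have r: "r > 0" "r * r = p\<^sup>2 + q\<^sup>2" unfolding r_def by auto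
  have "(p / r)\<^sup>2 + (- q / r)\<^sup>2 = (p\<^sup>2 + q\<^sup>2) / (r * r)"
    by (simp add: power_divide add_divide_distrib power2_eq_square)
  also have "\<dots> = 1" unfolding r(2) using False by (intro divide_self) simp
  finally obtain x where x: "p / r = cos x" "- q / r = sin x" by (metis sincos_total_2pi)
  have "p * cos x - q * sin x = (p * p + q * q) / r"
    unfolding x[symmetric] by (simp add: add_divide_distrib)
  also have "\<dots> = (r * r) / r" using r(2) by (simp add: power2_eq_square)
  also have "\<dots> = r" using r(1) by simp
  finally have "p * cos x - q * sin x = r" .
  moreover have "p * sin x + q * cos x = 0" unfolding x[symmetric] by simp
  ultimately show ?thesis unfolding r_def by blast
qed

lemma majorana_sum_split:
  assumes "m \<in> {1..2 * n}"
  shows "majorana_sum n v = of_real (v m) \<cdot>\<^sub>m majorana n m + majorana_sum n (v(m := 0))"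
proof (rule square_mat_eqI[of _ "2 ^ n"])
  fix i j :: nat assume ij: "i < 2 ^ n" "j < 2 ^ n"
  have "(\<Sum>\<nu>\<in>{1..2 * n} - {m}. complex_of_real (v \<nu>) * majorana n \<nu> $$ (i, j)) =
    (\<Sum>\<nu>\<in>{1..2 * n}. complex_of_real ((v(m := 0)) \<nu>) * majorana n \<nu> $$ (i, j))"
    by (rule sum.mono_neutral_cong_left) auto
  then show "majorana_sum n v $$ (i, j) = (of_real (v m) \<cdot>\<^sub>m majorana n m + majorana_sum n (v(m := 0))) $$ (i, j)"
    using ij majorana_carrier[OF assms]
      sum.remove[OF finite_atLeastAtMost assms, of "\<lambda>\<nu>. complex_of_real (v \<nu>) * majorana n \<nu> $$ (i, j)"]
    unfolding mat_lincomb_def by simp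
qed (use assms in auto)

text \<open>A sweep of Givens rotations from index \<open>2 * n\<close> down to j, one per adjacent
  plane. For \<open>j = 2 * n\<close> no rotation takes place and the sign of the coefficient is
  whatever it was, which is why \<open>c \<ge> 0\<close> is claimed only below
  \<open>2 * n\<close>.\<close>

lemma rotate_vector_to_axis:
  assumes l: "2 \<le> l" and j: "1 \<le> j" "j \<le> 2 * n"
    and v: "\<And>\<nu>. \<nu> \<in> {1..<j} \<Longrightarrow> v \<nu> = 0"
  shows "\<exists>g c. circuit n l (2 * n - j) g \<and> linear_gaussian n g \<and>
    (\<forall>\<mu>\<in>{1..<j}. conj_by g (majorana n \<mu>) = majorana n \<mu>) \<and>
    conj_by g (majorana_sum n v) = of_real c \<cdot>\<^sub>m majorana n j \<and> (j < 2 * n \<longrightarrow> c \<ge> 0)"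
  using j(2) v
proof (induction arbitrary: v rule: inc_induct)
  case base
  have "majorana_sum n (v(2 * n := 0)) = 0\<^sub>m (2 ^ n) (2 ^ n)"
    using base.prems unfolding mat_lincomb_def by (intro eq_matI) (auto intro!: sum.neutral)
  then have "majorana_sum n v = of_real (v (2 * n)) \<cdot>\<^sub>m majorana n (2 * n)"
    using majorana_sum_split[of "2 * n" n v] j majorana_carrier[of "2 * n" n] by simp
  then show ?case using linear_gaussian_one j
    by (intro exI[of _ "1\<^sub>m (2 ^ n)"] exI[of _ "v (2 * n)"]) auto
next
  case (step m)
  have m: "m \<in> {1..2 * n}" "Suc m \<in> {1..2 * n}" using step.hyps j by auto
  \<comment> \<open>The tail beyond m. The inner circuit gathers it on \<open>\<gamma>\<close> with
    index \<open>Suc m\<close> and fixes \<open>\<gamma>\<close> with index m, so one rotation of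
    these two finishes.\<close>
  define w where "w = v(m := 0)"
  have "w \<nu> = 0" if "\<nu> \<in> {1..<Suc m}" for \<nu>
    using step.prems[of \<nu>] that unfolding w_def by (cases "\<nu> = m") auto
  then obtain g c where g: "circuit n l (2 * n - Suc m) g" "linear_gaussian n g"
    "\<forall>\<mu>\<in>{1..<Suc m}. conj_by g (majorana n \<mu>) = majorana n \<mu>"
    "conj_by g (majorana_sum n w) = of_real c \<cdot>\<^sub>m majorana n (Suc m)"
    using step.IH[of w] by blast
  obtain x where x: "v m * cos x - c * sin x = sqrt ((v m)\<^sup>2 + c\<^sup>2)" "v m * sin x + c * cos x = 0"
    using rotation_angle_exists by blast
  obtain h where h: "circuit n l 1 h"
    "conj_by h (majorana n m) = of_real (cos x) \<cdot>\<^sub>m majorana n m + of_real (sin x) \<cdot>\<^sub>m majorana n (Suc m)"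
    "conj_by h (majorana n (Suc m)) = of_real (- sin x) \<cdot>\<^sub>m majorana n m + of_real (cos x) \<cdot>\<^sub>m majorana n (Suc m)"
    "\<forall>\<mu>\<in>{1..2 * n} - {m, Suc m}. conj_by h (majorana n \<mu>) = majorana n \<mu>"
    using majorana_rotation[OF l m] by blast
  have hlin: "linear_gaussian n h"
    unfolding linear_gaussian_def
  proof (intro conjI ballI)
    show "unitary_mat (2 ^ n) h" by (rule circuit_unitary[OF h(1)])
    fix \<mu> assume mu: "\<mu> \<in> {1..2 * n}"
    show "majorana_linear n (conj_by h (majorana n \<mu>))"
    proof (cases "\<mu> \<in> {m, Suc m}")
      case True
      then consider "\<mu> = m" | "\<mu> = Suc m" by blast
      then show ?thesis
        by cases (simp_all only: h(2,3) majorana_linear_comb2 majorana_linear_majorana m)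
    next
      case False
      then show ?thesis using h(4) mu by simp
    qed
  qed
  note gc = linear_gaussianD(2)[OF g(2)] and hc = linear_gaussianD(2)[OF hlin]
  note mc = majorana_carrier[OF m(1)] majorana_carrier[OF m(2)]
  have "conj_by g (majorana_sum n v) = of_real (v m) \<cdot>\<^sub>m majorana n m + of_real c \<cdot>\<^sub>m majorana n (Suc m)"
    using majorana_sum_split[OF m(1), of v] g(3,4) m gc mc unfolding w_def
    by (simp add: conj_by_add[of _ "2 ^ n"] conj_by_smult[of _ "2 ^ n"])
  then have "conj_by (g * h) (majorana_sum n v) =
      of_real (v m) \<cdot>\<^sub>m (of_real (cos x) \<cdot>\<^sub>m majorana n m + of_real (sin x) \<cdot>\<^sub>m majorana n (Suc m)) +
      of_real c \<cdot>\<^sub>m (of_real (- sin x) \<cdot>\<^sub>m majorana n m + of_real (cos x) \<cdot>\<^sub>m majorana n (Suc m))"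
    using gc hc mc h(2,3)
    by (simp add: conj_by_comp[of _ "2 ^ n"] conj_by_add[of _ "2 ^ n"] conj_by_smult[of _ "2 ^ n"])
  also have "\<dots> = of_real (v m * cos x - c * sin x) \<cdot>\<^sub>m majorana n m + of_real (v m * sin x + c * cos x) \<cdot>\<^sub>m majorana n (Suc m)"
    using mc by (intro square_mat_eqI[of _ "2 ^ n"]) (auto simp: algebra_simps)
  also have "\<dots> = of_real (sqrt ((v m)\<^sup>2 + c\<^sup>2)) \<cdot>\<^sub>m majorana n m"
    unfolding x using mc by (intro square_mat_eqI[of _ "2 ^ n"]) auto
  finally have "conj_by (g * h) (majorana_sum n v) = of_real (sqrt ((v m)\<^sup>2 + c\<^sup>2)) \<cdot>\<^sub>m majorana n m" .
  moreover have "conj_by (g * h) (majorana n \<mu>) = majorana n \<mu>" if "\<mu> \<in> {1..<m}" for \<mu>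
    using that g(3) h(4) m gc hc by (simp add: conj_by_comp[of _ "2 ^ n"])
  moreover have "circuit n l (2 * n - m) (g * h)"
    using circuit_mult[OF g(1) h(1)] step.hyps by (simp add: Suc_diff_Suc)
  moreover have "linear_gaussian n (g * h)" using linear_gaussian_mult[OF g(2) hlin] .
  ultimately show ?case
    by (intro exI[of _ "g * h"] exI[of _ "sqrt ((v m)\<^sup>2 + c\<^sup>2)"]) simp
qed

subsection \<open>Elimination\<close>

text \<open>The Clifford relations make the anticommutator with \<open>\<gamma>\<^sub>j\<close> a
  coefficient functional.\<close>

lemma majorana_sum_anticommutator:
  assumes j: "j \<in> {1..2 * n}"
  shows "majorana_sum n v * majorana n j + majorana n j * majorana_sum n v = of_real (2 * v j) \<cdot>\<^sub>m 1\<^sub>m (2 ^ n)"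
proof -
  let ?C = "\<lambda>\<nu>. majorana n \<nu> * majorana n j + majorana n j * majorana n \<nu>"
  have C: "?C \<nu> = (if \<nu> = j then 2 \<cdot>\<^sub>m 1\<^sub>m (2 ^ n) else 0\<^sub>m (2 ^ n) (2 ^ n))" if "\<nu> \<in> {1..2 * n}" for \<nu>
  proof (cases "\<nu> = j")
    case True
    then show ?thesis using j by (intro square_mat_eqI[of _ "2 ^ n"]) auto
  next
    case False
    then show ?thesis
      using majorana_anticommute[OF that j False] majorana_carrier[OF j] majorana_carrier[OF that]
      by (auto intro!: eq_matI)
  qed
  have "majorana_sum n v * majorana n j + majorana n j * majorana_sum n v = mat_lincomb (2 ^ n) {1..2 * n} v ?C"
  proof -
    have B: "majorana n \<nu> \<in> carrier_mat (2 ^ n) (2 ^ n)" if "\<nu> \<in> {1..2 * n}" for \<nu>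
      using that by (rule majorana_carrier)
    have "majorana_sum n v * majorana n j = mat_lincomb (2 ^ n) {1..2 * n} v (\<lambda>\<nu>. majorana n \<nu> * majorana n j)"
      by (rule mat_lincomb_mult_right[OF B B[OF j]])
    moreover have "majorana n j * majorana_sum n v = mat_lincomb (2 ^ n) {1..2 * n} v (\<lambda>\<nu>. majorana n j * majorana n \<nu>)"
      by (rule mat_lincomb_mult_left[OF B B[OF j]])
    moreover have "mat_lincomb (2 ^ n) {1..2 * n} v (\<lambda>\<nu>. majorana n \<nu> * majorana n j) +
        mat_lincomb (2 ^ n) {1..2 * n} v (\<lambda>\<nu>. majorana n j * majorana n \<nu>) =
        mat_lincomb (2 ^ n) {1..2 * n} v ?C"
      by (rule mat_lincomb_add) (use B B[OF j] in \<open>simp_all only: square_mult_carrier\<close>)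
    ultimately show ?thesis by simp
  qed
  also have "\<dots> = of_real (2 * v j) \<cdot>\<^sub>m 1\<^sub>m (2 ^ n)"
  proof (rule square_mat_eqI[of _ "2 ^ n"])
    fix a b :: nat assume ab: "a < 2 ^ n" "b < 2 ^ n"
    have "(\<Sum>\<nu>\<in>{1..2 * n}. complex_of_real (v \<nu>) * ?C \<nu> $$ (a, b)) =
        (\<Sum>\<nu>\<in>{1..2 * n}. if \<nu> = j then complex_of_real (2 * v \<nu>) * 1\<^sub>m (2 ^ n) $$ (a, b) else 0)"
      by (rule sum.cong[OF refl], subst C) (use ab in auto)
    then show "mat_lincomb (2 ^ n) {1..2 * n} v ?C $$ (a, b) = (of_real (2 * v j) \<cdot>\<^sub>m 1\<^sub>m (2 ^ n)) $$ (a, b)"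
      using ab j unfolding mat_lincomb_def by (cases "a = b") simp_all
  qed simp_all
  finally show ?thesis .
qed

lemma smult_one_mat_eq_iff:
  assumes "0 < d"
  shows "a \<cdot>\<^sub>m 1\<^sub>m d = (b :: complex) \<cdot>\<^sub>m 1\<^sub>m d \<longleftrightarrow> a = b"
proof
  assume "a \<cdot>\<^sub>m 1\<^sub>m d = b \<cdot>\<^sub>m 1\<^sub>m d"
  then have "(a \<cdot>\<^sub>m 1\<^sub>m d) $$ (0, 0) = (b \<cdot>\<^sub>m 1\<^sub>m d) $$ (0, 0)" by simp
  then show "a = b" using assms by simp
qed simp

lemma smult_mult_smult_mat:
  fixes A :: "complex mat"
  assumes "A \<in> carrier_mat d d" "B \<in> carrier_mat d d"
  shows "(a \<cdot>\<^sub>m A) * (b \<cdot>\<^sub>m B) = (a * b) \<cdot>\<^sub>m (A * B)"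
  using assms by (simp add: mult_smult_assoc_mat[of _ d d _ d] mult_smult_distrib[of _ d d _ d] smult_smult_mat mult.commute)

text \<open>Orthogonality of the rows need not be tracked: the already reduced
  images are \<open>\<plusminus>\<gamma>\<^sub>1, \<dots>, \<plusminus>\<gamma>\<^sub>k\<close>, and anticommuting with them forces the next
  image to have no component along them.\<close>

lemma simultaneous_reduction:
  assumes l: "2 \<le> l" and F: "linear_gaussian n F"
    and m: "inj_on m {1..k}" "m ` {1..k} \<subseteq> {1..2 * n}"
  shows "\<exists>g. circuit n l (k * (2 * n)) g \<and> linear_gaussian n g \<and>
    (\<forall>j\<in>{1..k}. \<exists>c :: real. c * c = 1 \<and> (j < 2 * n \<longrightarrow> c = 1) \<and>
      conj_by (F * g) (majorana n (m j)) = of_real c \<cdot>\<^sub>m majorana n j)"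
  using m
proof (induction k)
  case 0
  then show ?case using linear_gaussian_one[of n] by (intro exI[of _ "1\<^sub>m (2 ^ n)"]) simp
next
  case (Suc k)
  have "inj_on m {1..k}" "m ` {1..k} \<subseteq> {1..2 * n}"
    using Suc.prems by (auto intro: inj_on_subset)
  then obtain g where g: "circuit n l (k * (2 * n)) g" "linear_gaussian n g"
    "\<forall>j\<in>{1..k}. \<exists>c :: real. c * c = 1 \<and> (j < 2 * n \<longrightarrow> c = 1) \<and>
      conj_by (F * g) (majorana n (m j)) = of_real c \<cdot>\<^sub>m majorana n j"
    using Suc.IH by blast
  \<comment> \<open>Injectivity of m into the \<open>2 * n\<close> labels guarantees that a target
    axis with index \<open>Suc k\<close> exists.\<close>
  have "card {1..Suc k} \<le> card {1..2 * n}"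
    by (rule card_inj_on_le[OF Suc.prems]) simp
  then have k: "Suc k \<le> 2 * n" by simp
  let ?d = "2 ^ n :: nat" and ?\<mu> = "m (Suc k)"
  have mu: "?\<mu> \<in> {1..2 * n}" using Suc.prems(2) by (rule subsetD) simp
  have Fg: "linear_gaussian n (F * g)" using linear_gaussian_mult[OF F g(2)] .
  note U = linear_gaussianD(1)[OF Fg]
  obtain v where v: "conj_by (F * g) (majorana n ?\<mu>) = majorana_sum n v"
    using linear_gaussianD(3)[OF Fg mu] unfolding majorana_linear_def by blast
  have vj: "v j = 0" if "j \<in> {1..<Suc k}" for j
  proof -
    have j: "j \<in> {1..k}" "j \<in> {1..2 * n}" "j \<in> {1..Suc k}" "j \<noteq> Suc k" using that k by auto
    have mj: "m j \<in> {1..2 * n}" using Suc.prems(2) j(3) by blast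
    have "m j \<noteq> ?\<mu>" using inj_onD[OF Suc.prems(1) _ j(3)] j(4) by fastforce
    note mj = mj this
    obtain c :: real where c: "c * c = 1" "conj_by (F * g) (majorana n (m j)) = of_real c \<cdot>\<^sub>m majorana n j"
      using g(3) j(1) by blast
    let ?A = "majorana_sum n v" and ?B = "majorana n j"
    have B: "?B \<in> carrier_mat ?d ?d" using j(2) by simp
    have "?A * (of_real c \<cdot>\<^sub>m ?B) = conj_by (F * g) (majorana n ?\<mu> * majorana n (m j))"
      using mu mj by (simp add: conj_by_mult[OF U] v c(2))
    also have "majorana n ?\<mu> * majorana n (m j) = - 1 \<cdot>\<^sub>m (majorana n (m j) * majorana n ?\<mu>)"
      using majorana_anticommute[OF mu mj(1) mj(2)[symmetric]] .
    also have "conj_by (F * g) \<dots> = - 1 \<cdot>\<^sub>m ((of_real c \<cdot>\<^sub>m ?B) * ?A)"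
      using mu mj by (simp add: conj_by_smult[OF unitary_matD(1)[OF U]] conj_by_mult[OF U] v c(2))
    finally have "of_real c \<cdot>\<^sub>m (?A * ?B) = - of_real c \<cdot>\<^sub>m (?B * ?A)"
      using B by (simp add: mult_smult_distrib[of _ ?d ?d _ ?d] mult_smult_assoc_mat[of _ ?d ?d _ ?d] smult_smult_mat)
    \<comment> \<open>Multiplying once more by c removes the unknown sign, since
      \<open>c * c = 1\<close>.\<close>
    then have "of_real c \<cdot>\<^sub>m (of_real c \<cdot>\<^sub>m (?A * ?B)) = of_real c \<cdot>\<^sub>m (- of_real c \<cdot>\<^sub>m (?B * ?A))"
      by simp
    then have "?A * ?B = - 1 \<cdot>\<^sub>m (?B * ?A)"
      using c(1) by (simp add: smult_smult_mat of_real_mult[symmetric] del: of_real_mult)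
    moreover have "- 1 \<cdot>\<^sub>m X + X = 0 \<cdot>\<^sub>m 1\<^sub>m ?d" if "X \<in> carrier_mat ?d ?d" for X :: "complex mat"
      using that by (auto intro!: eq_matI)
    ultimately have "?A * ?B + ?B * ?A = 0 \<cdot>\<^sub>m 1\<^sub>m ?d"
      using B by simp
    then have "of_real (2 * v j) \<cdot>\<^sub>m 1\<^sub>m ?d = (0 :: complex) \<cdot>\<^sub>m 1\<^sub>m ?d"
      using majorana_sum_anticommutator[OF j(2), of v] by simp
    then have "complex_of_real (2 * v j) = 0"
      using smult_one_mat_eq_iff[of ?d "complex_of_real (2 * v j)" 0] by simp
    then show ?thesis by simp
  qed
  obtain h c where h: "circuit n l (2 * n - Suc k) h" "linear_gaussian n h"
    "\<forall>\<mu>\<in>{1..<Suc k}. conj_by h (majorana n \<mu>) = majorana n \<mu>"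
    "conj_by h (majorana_sum n v) = of_real c \<cdot>\<^sub>m majorana n (Suc k)" "Suc k < 2 * n \<longrightarrow> c \<ge> 0"
    using rotate_vector_to_axis[OF l _ k, of v] vj by auto
  have conj: "conj_by (F * (g * h)) (majorana n \<nu>) = conj_by h (conj_by (F * g) (majorana n \<nu>))"
    if "\<nu> \<in> {1..2 * n}" for \<nu>
    using that linear_gaussianD(2)[OF F] linear_gaussianD(2)[OF g(2)] linear_gaussianD(2)[OF h(2)]
    by (simp add: conj_by_comp[of _ ?d, symmetric] assoc_mult_mat[of _ ?d ?d _ ?d _ ?d])
  have img: "conj_by (F * (g * h)) (majorana n ?\<mu>) = of_real c \<cdot>\<^sub>m majorana n (Suc k)"
    using conj[OF mu] v h(4) by simp
  \<comment> \<open>Majorana operators square to the identity and conjugation preserves this, so the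
    surviving coefficient is 1 or -1. Nonnegativity then settles it on every axis but the
    last.\<close>
  have cc: "c * c = 1"
  proof -
    have W: "unitary_mat ?d (F * (g * h))"
      using linear_gaussianD(1)[OF linear_gaussian_mult[OF F linear_gaussian_mult[OF g(2) h(2)]]] .
    have "1\<^sub>m ?d = conj_by (F * (g * h)) (majorana n ?\<mu> * majorana n ?\<mu>)"
      using mu W by simp
    also have "\<dots> = (of_real c \<cdot>\<^sub>m majorana n (Suc k)) * (of_real c \<cdot>\<^sub>m majorana n (Suc k))"
      unfolding conj_by_mult[OF W majorana_carrier[OF mu] majorana_carrier[OF mu]] img ..
    also have "\<dots> = of_real (c * c) \<cdot>\<^sub>m 1\<^sub>m ?d"
      using k by (simp add: smult_mult_smult_mat[of _ ?d])
    finally have "of_real (c * c) \<cdot>\<^sub>m 1\<^sub>m ?d = (1 :: complex) \<cdot>\<^sub>m 1\<^sub>m ?d" by simp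
    then have "complex_of_real (c * c) = 1"
      using smult_one_mat_eq_iff[of ?d "complex_of_real (c * c)" 1] by simp
    then show ?thesis using of_real_eq_1_iff by blast
  qed
  have c1: "c = 1" if "Suc k < 2 * n"
    using cc h(5) that by (auto simp: square_eq_1_iff)
  have "\<exists>c :: real. c * c = 1 \<and> (j < 2 * n \<longrightarrow> c = 1) \<and>
      conj_by (F * (g * h)) (majorana n (m j)) = of_real c \<cdot>\<^sub>m majorana n j" if j: "j \<in> {1..Suc k}" for j
  proof (cases "j = Suc k")
    case True
    then show ?thesis using img cc c1 by blast
  next
    case False
    then have j': "j \<in> {1..k}" "j \<in> {1..2 * n}" "m j \<in> {1..2 * n}"
      using j k subsetD[OF Suc.prems(2) imageI[OF j]] by auto
    obtain c :: real where c: "c * c = 1" "j < 2 * n \<longrightarrow> c = 1"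
      "conj_by (F * g) (majorana n (m j)) = of_real c \<cdot>\<^sub>m majorana n j"
      using g(3) j'(1) by blast
    have "conj_by (F * (g * h)) (majorana n (m j)) = of_real c \<cdot>\<^sub>m majorana n j"
      using conj[OF j'(3)] c(3) h(3) j' linear_gaussianD(2)[OF h(2)]
      by (simp add: conj_by_smult[of _ ?d])
    then show ?thesis using c by blast
  qed
  moreover have "circuit n l (Suc k * (2 * n)) (g * h)"
    using circuit_mono[OF circuit_mult[OF g(1) h(1)]] by simp
  moreover have "linear_gaussian n (g * h)" using linear_gaussian_mult[OF g(2) h(2)] .
  ultimately show ?case by blast
qed

lemma conj_by_first_majorana:
  assumes "\<mu> \<in> {1..2 * n}"
  shows "conj_by (majorana n 1) (majorana n \<mu>) = (if \<mu> = 1 then 1 else - 1) \<cdot>\<^sub>m majorana n \<mu>"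
proof -
  let ?d = "2 ^ n :: nat"
  have 1: "1 \<in> {1..2 * n}" using assms by auto
  show ?thesis
  proof (cases "\<mu> = 1")
    case True
    then show ?thesis using 1 left_mult_one_mat[OF majorana_carrier[OF 1]] unfolding conj_by_def by simp
  next
    case False
    have "majorana n 1 * majorana n \<mu> * majorana n 1 = - 1 \<cdot>\<^sub>m (majorana n \<mu> * (majorana n 1 * majorana n 1))"
      unfolding majorana_anticommute[OF 1 assms False[symmetric]]
      using majorana_carrier[OF 1] majorana_carrier[OF assms]
      by (simp add: mult_smult_assoc_mat[of _ ?d ?d _ ?d] assoc_mult_mat[of _ ?d ?d _ ?d _ ?d] del: majorana_square)
    then show ?thesis using False 1 majorana_carrier[OF assms] unfolding conj_by_def
      by (simp del: One_nat_def)
  qed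
qed

text \<open>Conjugation by \<open>\<gamma>\<^sub>1 \<dots> \<gamma>\<^sub>2\<^sub>k\<^sub>-\<^sub>1\<close>.
  For \<open>k = n\<close> it reflects the last axis, which local rotations alone cannot do.\<close>

lemma majorana_reflection:
  assumes l: "2 \<le> l" and k: "1 \<le> k" "k \<le> n"
  shows "\<exists>R. circuit n l k R \<and>
    (\<forall>\<mu>\<in>{1..2 * n}. conj_by R (majorana n \<mu>) = (if \<mu> < 2 * k then 1 else - 1) \<cdot>\<^sub>m majorana n \<mu>)"
  using k
proof (induction k rule: dec_induct)
  case base
  let ?d = "2 ^ n :: nat" and ?P = "majorana n 1"
  have 1: "1 \<in> {1..2 * n}" using base by auto
  have "hermitian_mat ?d ?P" using 1 unfolding hermitian_mat_def by simp
  moreover have "?P \<in> generated_algebra ?d (majorana n ` {1})" by (intro generated_algebra.gen) simp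
  moreover have "supported_on n [1..<Suc 1] ?P" using 1 by (intro supported_on_majorana) auto
  ultimately have "local_generator n l ?P"
    using 1 base l by (intro local_generatorI[of _ _ "{1}" _ "[1..<Suc 1]"]) auto
  \<comment> \<open>At angle \<open>pi / 2\<close> the exponential is \<open>\<i>\<close> times the
    operator itself; the phase \<open>\<i>\<close> cancels under conjugation.\<close>
  from circuit_gate[OF local_generator_smult_real[OF this, of "pi / 2"]]
  moreover have "(0 :: complex) \<cdot>\<^sub>m 1\<^sub>m ?d + \<i> \<cdot>\<^sub>m ?P = \<i> \<cdot>\<^sub>m ?P"
    using majorana_carrier[OF 1] by (auto intro!: eq_matI)
  ultimately have R: "circuit n l 1 (\<i> \<cdot>\<^sub>m ?P)"
    using mat_exp_involution[OF majorana_carrier[OF 1] majorana_square[OF 1], of "pi / 2"]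
    by (simp del: One_nat_def)
  have "conj_by (\<i> \<cdot>\<^sub>m ?P) A = conj_by ?P A" if "A \<in> carrier_mat ?d ?d" for A
    using majorana_carrier[OF 1] that 1 unfolding conj_by_def
    by (simp add: mat_adjoint_smult mult_smult_assoc_mat[of _ ?d ?d _ ?d] mult_smult_distrib[of _ ?d ?d _ ?d]
        smult_smult_mat del: One_nat_def)
  then have "conj_by (\<i> \<cdot>\<^sub>m ?P) (majorana n \<mu>) = (if \<mu> < 2 * 1 then 1 else - 1) \<cdot>\<^sub>m majorana n \<mu>"
    if "\<mu> \<in> {1..2 * n}" for \<mu>
    using conj_by_first_majorana[OF that] that by auto
  then show ?case using R by blast
next
  case (step k)
  let ?d = "2 ^ n :: nat"
  have a: "2 * k \<in> {1..2 * n}" "Suc (2 * k) \<in> {1..2 * n}" using step by auto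
  obtain R where R: "circuit n l k R"
    "\<forall>\<mu>\<in>{1..2 * n}. conj_by R (majorana n \<mu>) = (if \<mu> < 2 * k then 1 else - 1) \<cdot>\<^sub>m majorana n \<mu>"
    using step by auto
  \<comment> \<open>A half turn negates both axes of its plane. It restores the signs at
    \<open>2 * k\<close> and \<open>Suc (2 * k)\<close>, moving the threshold up by two.\<close>
  obtain h where h: "circuit n l 1 h"
    "conj_by h (majorana n (2 * k)) = - 1 \<cdot>\<^sub>m majorana n (2 * k)"
    "conj_by h (majorana n (Suc (2 * k))) = - 1 \<cdot>\<^sub>m majorana n (Suc (2 * k))"
    "\<forall>\<mu>\<in>{1..2 * n} - {2 * k, Suc (2 * k)}. conj_by h (majorana n \<mu>) = majorana n \<mu>"
  proof -
    have "of_real (cos pi) \<cdot>\<^sub>m A + of_real (sin pi) \<cdot>\<^sub>m B = - 1 \<cdot>\<^sub>m A"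
      "of_real (- sin pi) \<cdot>\<^sub>m A + of_real (cos pi) \<cdot>\<^sub>m B = - 1 \<cdot>\<^sub>m B"
      if "A \<in> carrier_mat ?d ?d" "B \<in> carrier_mat ?d ?d" for A B :: "complex mat"
      using that by (auto intro!: eq_matI)
    then show ?thesis using majorana_rotation[OF l a, of pi] majorana_carrier[OF a(1)] majorana_carrier[OF a(2)] that
      by metis
  qed
  note Rc = unitary_matD(1)[OF circuit_unitary[OF R(1)]] and hc = unitary_matD(1)[OF circuit_unitary[OF h(1)]]
  have "conj_by (R * h) (majorana n \<mu>) = (if \<mu> < 2 * Suc k then 1 else - 1) \<cdot>\<^sub>m majorana n \<mu>"
    if mu: "\<mu> \<in> {1..2 * n}" for \<mu>
  proof -
    have "conj_by (R * h) (majorana n \<mu>) = (if \<mu> < 2 * k then 1 else - 1) \<cdot>\<^sub>m conj_by h (majorana n \<mu>)"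
      using R(2) mu Rc hc by (simp add: conj_by_comp[of _ ?d] conj_by_smult[of _ ?d])
    moreover have "conj_by h (majorana n \<mu>) = (if \<mu> \<in> {2 * k, Suc (2 * k)} then - 1 else 1) \<cdot>\<^sub>m majorana n \<mu>"
      using h(2-4) mu by auto
    ultimately show ?thesis by (auto simp: smult_smult_mat)
  qed
  moreover have "circuit n l (Suc k) (R * h)" using circuit_mult[OF R(1) h(1)] by simp
  ultimately show ?case by blast
qed

section \<open>The commutant of the Majorana operators and exact synthesis of Gaussian
  unitaries\<close>

text \<open>Inverts the Jordan-Wigner map: Z at k is \<open>- \<i>\<close> times the product of the
  two Majorana operators on qubit k, and X at k is the Z string before k times the first of
  them.\<close>

lemma supported_on_nilI:
  assumes F: "F \<in> carrier_mat (2 ^ n) (2 ^ n)"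
    and comm: "\<And>\<mu>. \<mu> \<in> {1..2 * n} \<Longrightarrow> F * majorana n \<mu> = majorana n \<mu> * F"
  shows "supported_on n [] F"
proof -
  let ?d = "2 ^ n :: nat"
  have Z: "F * on_qubit n k pauli_z = on_qubit n k pauli_z * F" if k: "k \<in> {1..n}" for k
  proof -
    have a: "2 * k - 1 \<in> {1..2 * n}" "2 * k \<in> {1..2 * n}" using k by auto
    have ka: "(2 * k - 1 + 1) div 2 = k" "(2 * k + 1) div 2 = k" "odd (2 * k - 1)" using k by auto
    have "majorana_coeff n (2 * k - 1) i * majorana_coeff n (2 * k) (flip_bit (n - k) i) = \<i> * z_sign n k i" for i
    proof -
      have "majorana_coeff n (2 * k) (flip_bit (n - k) i) = - majorana_coeff n (2 * k) i"
        using majorana_coeff_flip[OF a(2) k] unfolding ka by simp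
      moreover have "majorana_coeff n (2 * k) i = jw_sign n k i * (if bit i (n - k) then \<i> else - \<i>)"
        "majorana_coeff n (2 * k - 1) i = jw_sign n k i"
        unfolding majorana_coeff_def ka(1,2) using ka(3) by simp_all
      ultimately show ?thesis using jw_sign_square[of n k i]
        by (simp add: z_sign_def mult.assoc[symmetric])
    qed
    then have "majorana n (2 * k - 1) * majorana n (2 * k) = \<i> \<cdot>\<^sub>m on_qubit n k pauli_z"
      unfolding majorana_monomial[OF a(1)] majorana_monomial[OF a(2)] ka
      using qubit_flip_less[OF k]
      by (simp add: monomial_mat_mult on_qubit_pauli_monomial[OF k] monomial_mat_smult)
    then have "on_qubit n k pauli_z = - \<i> \<cdot>\<^sub>m (majorana n (2 * k - 1) * majorana n (2 * k))"
      by (simp add: smult_smult_mat)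
    moreover have "F * (majorana n (2 * k - 1) * majorana n (2 * k)) = majorana n (2 * k - 1) * majorana n (2 * k) * F"
      using F a comm by (intro mat_commute_mult[of _ ?d]) auto
    ultimately show ?thesis
      using F majorana_carrier[OF a(1)] majorana_carrier[OF a(2)]
      by (simp add: mult_smult_assoc_mat[of _ ?d ?d _ ?d] mult_smult_distrib[of _ ?d ?d _ ?d])
  qed
  have X: "F * on_qubit n k pauli_x = on_qubit n k pauli_x * F" if k: "k \<in> {1..n}" for k
  proof -
    have a: "2 * k - 1 \<in> {1..2 * n}" and ka: "(2 * k - 1 + 1) div 2 = k" "odd (2 * k - 1)" using k by auto
    define S where "S = mat_prod_list ?d (map (\<lambda>j. on_qubit n j pauli_z) [1..<k])"
    have S: "S = monomial_mat ?d (\<lambda>i. i) (jw_sign n k)"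
      using k unfolding S_def by (intro z_string_upt_monomial) simp
    have comm_string: "F * mat_prod_list ?d (map (\<lambda>j. on_qubit n j pauli_z) xs) =
        mat_prod_list ?d (map (\<lambda>j. on_qubit n j pauli_z) xs) * F" if "set xs \<subseteq> {1..n}" for xs
      using that
    proof (induction xs)
      case (Cons x xs)
      have "mat_prod_list ?d (map (\<lambda>j. on_qubit n j pauli_z) xs) \<in> carrier_mat ?d ?d"
        using Cons.prems by (intro mat_prod_list_carrier) auto
      then show ?case
        using F Z[of x] Cons by (simp, intro mat_commute_mult[of _ ?d]) auto
    qed (use F in simp)
    have FS: "F * S = S * F" unfolding S_def by (rule comm_string) (use k in auto)
    have "majorana n (2 * k - 1) = S * on_qubit n k pauli_x"
      unfolding majorana_def Let_def ka S_def using ka(2) by simp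
    then have "S * majorana n (2 * k - 1) = on_qubit n k pauli_x"
      using k unfolding S by (simp add: on_qubit_pauli_monomial monomial_mat_mult)
    moreover have "F * (S * majorana n (2 * k - 1)) = S * majorana n (2 * k - 1) * F"
      using F a FS comm[OF a] unfolding S by (intro mat_commute_mult[of _ ?d]) auto
    ultimately show ?thesis by simp
  qed
  show ?thesis unfolding supported_on_def using F X Z by auto
qed

text \<open>Unitarity puts c on the unit circle, so it is a phase with a multiple of the identity as
  generator. This generator needs no Majorana operator and no qubit, hence the empty sets.\<close>

lemma circuit_scalar:
  assumes U: "unitary_mat (2 ^ n) (c \<cdot>\<^sub>m 1\<^sub>m (2 ^ n))"
  shows "circuit n l 1 (c \<cdot>\<^sub>m 1\<^sub>m (2 ^ n))"
proof -
  let ?d = "2 ^ n :: nat"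
  have "(cnj c * c) \<cdot>\<^sub>m 1\<^sub>m ?d = (1 :: complex) \<cdot>\<^sub>m 1\<^sub>m ?d"
    using unitary_matD(3)[OF U]
    by (simp add: mat_adjoint_smult smult_mult_smult_mat[of _ ?d])
  then have "cnj c * c = 1" using smult_one_mat_eq_iff[of ?d "cnj c * c" 1] by simp
  then have "of_real ((norm c)\<^sup>2) = (1 :: complex)" by (simp only: complex_norm_square mult.commute)
  then have "(norm c)\<^sup>2 = 1" using of_real_eq_1_iff by blast
  then have "norm c = 1" using norm_ge_zero[of c] by (auto simp: power2_eq_1_iff)
  then obtain x where x: "c = cis x" using cis_Arg[of c] by (metis div_by_1 norm_zero of_real_1 sgn_eq zero_neq_one)
  have gen: "local_generator n l (of_real x \<cdot>\<^sub>m 1\<^sub>m ?d)"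
    by (intro local_generator_smult_real local_generatorI[of _ _ "{}" _ "[]"])
       (auto simp: hermitian_mat_def intro: generated_algebra.one)
  have "mat_exp (\<i> \<cdot>\<^sub>m (of_real x \<cdot>\<^sub>m 1\<^sub>m ?d)) = c \<cdot>\<^sub>m 1\<^sub>m ?d"
    unfolding x by (subst mat_exp_involution[of _ ?d]) (auto intro!: eq_matI simp: complex_eq_iff)
  then show ?thesis using circuit_gate[OF gen] by simp
qed

text \<open>Full elimination determines F only up to the last sign and a phase. The three terms of
  the bound pay for the rotations, the reflection of the last axis, and the phase; F is then the
  phase times the inverse of the circuit h.\<close>

lemma gaussian_circuit:
  assumes l: "2 \<le> l" and n: "1 \<le> n" and F: "linear_gaussian n F"
  shows "circuit n l (4 * n ^ 2 + n + 1) F"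
proof -
  let ?d = "2 ^ n :: nat"
  obtain g where g: "circuit n l (2 * n * (2 * n)) g" "linear_gaussian n g"
    "\<forall>j\<in>{1..2 * n}. \<exists>c :: real. c * c = 1 \<and> (j < 2 * n \<longrightarrow> c = 1) \<and>
      conj_by (F * g) (majorana n j) = of_real c \<cdot>\<^sub>m majorana n j"
    using simultaneous_reduction[OF l F, of "\<lambda>j. j" "2 * n"] by auto
  have "2 * n \<in> {1..2 * n}" using n by auto
  then obtain s :: real where s: "s * s = 1" "conj_by (F * g) (majorana n (2 * n)) = of_real s \<cdot>\<^sub>m majorana n (2 * n)"
    using g(3) by blast
  have fixed: "conj_by (F * g) (majorana n j) = majorana n j" if "j \<in> {1..2 * n}" "j < 2 * n" for j
    using g(3) that by fastforce
  note Fc = linear_gaussianD(2)[OF F] and gc = linear_gaussianD(2)[OF g(2)]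
  have Fgc: "F * g \<in> carrier_mat ?d ?d" using Fc gc by simp
  have "\<exists>R. circuit n l n R \<and> (\<forall>j\<in>{1..2 * n}. conj_by (F * g * R) (majorana n j) = majorana n j)"
  proof (cases "s = 1")
    case True
    have "conj_by (F * g * 1\<^sub>m ?d) (majorana n j) = majorana n j" if "j \<in> {1..2 * n}" for j
      using fixed[OF that] s(2) True Fgc that by (cases "j < 2 * n") auto
    then show ?thesis using circuit_mono[OF circuit_one, of n] by blast
  next
    case False
    then have s1: "s = - 1" using s(1) square_eq_1_iff by blast
    obtain R where R: "circuit n l n R"
      "\<forall>\<mu>\<in>{1..2 * n}. conj_by R (majorana n \<mu>) = (if \<mu> < 2 * n then 1 else - 1) \<cdot>\<^sub>m majorana n \<mu>"
      using majorana_reflection[OF l n order_refl] by blast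
    note Rc = unitary_matD(1)[OF circuit_unitary[OF R(1)]]
    have "conj_by (F * g * R) (majorana n j) = majorana n j" if j: "j \<in> {1..2 * n}" for j
    proof -
      have c: "conj_by (F * g * R) (majorana n j) = conj_by R (conj_by (F * g) (majorana n j))"
        using j Rc Fgc by (intro conj_by_comp) auto
      show ?thesis
      proof (cases "j < 2 * n")
        case True
        then show ?thesis using c R(2) j fixed by simp
      next
        case False
        then have "j = 2 * n" using j by auto
        then show ?thesis using c R(2) j s(2) s1 Rc
          by (simp add: conj_by_smult[of _ ?d] smult_smult_mat)
      qed
    qed
    then show ?thesis using R(1) by blast
  qed
  then obtain R where R: "circuit n l n R" "\<forall>j\<in>{1..2 * n}. conj_by (F * g * R) (majorana n j) = majorana n j"
    by blast
  note Rc = unitary_matD(1)[OF circuit_unitary[OF R(1)]]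
  define h where "h = g * R"
  have h: "circuit n l (4 * n ^ 2 + n) h"
    using circuit_mult[OF g(1) R(1)] unfolding h_def by (simp add: power2_eq_square)
  note hu = unitary_matD[OF circuit_unitary[OF h]]
  have eq: "F * g * R = F * h" using Fc gc Rc unfolding h_def by (simp add: assoc_mult_mat[of _ ?d ?d _ ?d _ ?d])
  have U: "unitary_mat ?d (F * h)"
    by (rule unitary_mat_mult[OF linear_gaussianD(1)[OF F] circuit_unitary[OF h]])
  have "supported_on n [] (F * h)"
  proof (rule supported_on_nilI[OF unitary_matD(1)[OF U]])
    fix \<mu> assume mu: "\<mu> \<in> {1..2 * n}"
    show "F * h * majorana n \<mu> = majorana n \<mu> * (F * h)"
      using conj_by_eq_imp_commuting[OF U majorana_carrier[OF mu]] R(2) mu eq by simp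
  qed
  then obtain c where c: "F * h = c \<cdot>\<^sub>m 1\<^sub>m ?d" using supported_on_nil_scalar by blast
  have "circuit n l 1 (F * h)" using circuit_scalar U unfolding c by blast
  from circuit_mult[OF this circuit_adjoint[OF h]]
  have "circuit n l (4 * n ^ 2 + n + 1) (F * h * mat_adjoint h)" by (simp add: add.commute)
  moreover have "F * h * mat_adjoint h = F"
    using Fc hu by (simp add: assoc_mult_mat[of _ ?d ?d _ ?d _ ?d])
  ultimately show ?thesis by simp
qed

section \<open>Cost of a conjugated gate and collection of the Gaussian factors\<close>

lemma generated_algebra_conj:
  assumes U: "unitary_mat d U" and S: "S \<subseteq> carrier_mat d d"
    and img: "\<And>A. A \<in> S \<Longrightarrow> conj_by U A \<in> generated_algebra d T"
    and A: "A \<in> generated_algebra d S"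
  shows "conj_by U A \<in> generated_algebra d T"
  using A
proof induction
  case one
  show ?case using U by (simp add: generated_algebra.one)
next
  case (add A B)
  then show ?case using generated_algebra_carrier[OF _ S] unitary_matD(1)[OF U]
    by (simp add: conj_by_add[of _ d] generated_algebra.add)
next
  case (mult A B)
  then show ?case using generated_algebra_carrier[OF _ S]
    by (simp add: conj_by_mult[OF U] generated_algebra.mult)
next
  case (smult A c)
  then show ?case using generated_algebra_carrier[OF _ S] unitary_matD(1)[OF U]
    by (simp add: conj_by_smult[of _ d] generated_algebra.smult)
qed (rule img)

lemma supported_on_generated_algebra:
  assumes "A \<in> generated_algebra (2 ^ n) S" "\<And>B. B \<in> S \<Longrightarrow> supported_on n qs B"
  shows "supported_on n qs A"
  using assms by induction (auto intro: supported_on_add supported_on_mult supported_on_smult)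

text \<open>The generator H is transported by \<open>F * g\<close> into the algebra of the first k
  Majorana operators; undoing g around the resulting core gate gives back
  \<open>conj_by F W\<close>. Signs left by the reduction are harmless, as an algebra is closed
  under scalars.\<close>

lemma conjugated_gate_circuit:
  assumes l: "\<kappa> + 2 \<le> l" and F: "linear_gaussian n F" and W: "majorana_local_gate n \<kappa> W"
  shows "circuit n l (4 * \<kappa> * n + 1) (conj_by F W)"
proof -
  let ?d = "2 ^ n :: nat"
  obtain M H where M: "M \<subseteq> {1..2 * n}" "card M \<le> \<kappa>" and H: "hermitian_mat ?d H"
    "H \<in> generated_algebra ?d (majorana n ` M)" and WH: "W = mat_exp (\<i> \<cdot>\<^sub>m H)"
    using W unfolding majorana_local_gate_def by blast
  define k where "k = card M"
  have "finite M" using M(1) finite_subset by blast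
  then obtain m where m: "bij_betw m {1..k} M" unfolding k_def using ex_bij_betw_nat_finite_1 by blast
  then have minj: "inj_on m {1..k}" and mimg: "m ` {1..k} = M" by (auto simp: bij_betw_def)
  have k: "k \<le> \<kappa>" "k \<le> 2 * n"
    using M card_mono[OF _ M(1)] unfolding k_def by auto
  obtain g where g: "circuit n l (k * (2 * n)) g" "linear_gaussian n g"
    "\<forall>j\<in>{1..k}. \<exists>c :: real. c * c = 1 \<and> (j < 2 * n \<longrightarrow> c = 1) \<and>
      conj_by (F * g) (majorana n (m j)) = of_real c \<cdot>\<^sub>m majorana n j"
    using simultaneous_reduction[OF _ F minj, of l] mimg M(1) l by auto
  have U: "unitary_mat ?d (F * g)" using linear_gaussianD(1)[OF linear_gaussian_mult[OF F g(2)]] .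
  define H' where "H' = conj_by (F * g) H"
  have Hc: "H \<in> carrier_mat ?d ?d" using H(1) unfolding hermitian_mat_def by blast
  have herm: "hermitian_mat ?d H'"
    unfolding H'_def by (rule conj_by_hermitian[OF unitary_matD(1)[OF U] H(1)])
  have alg: "H' \<in> generated_algebra ?d (majorana n ` {1..k})"
    unfolding H'_def
  proof (rule generated_algebra_conj[OF U _ _ H(2)])
    show "majorana n ` M \<subseteq> carrier_mat ?d ?d" using M(1) by auto
    fix A assume "A \<in> majorana n ` M"
    then obtain j where j: "j \<in> {1..k}" "A = majorana n (m j)" unfolding mimg[symmetric] by blast
    then obtain c :: real where "conj_by (F * g) A = of_real c \<cdot>\<^sub>m majorana n j" using g(3) by blast
    then show "conj_by (F * g) A \<in> generated_algebra ?d (majorana n ` {1..k})"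
      using j(1) by (simp only:) (intro generated_algebra.smult generated_algebra.gen imageI)
  qed
  \<comment> \<open>Each qubit carries two Majorana operators, so the first k of them occupy k / 2
    qubits, rounded up.\<close>
  define q where "q = (k + 1) div 2"
  have q: "q \<le> n" "q \<le> l" "k \<le> 2 * q" using k l unfolding q_def by auto
  have "supported_on n [1..<Suc q] H'"
  proof (rule supported_on_generated_algebra[OF alg])
    fix B assume "B \<in> majorana n ` {1..k}"
    then obtain \<mu> where mu: "\<mu> \<in> {1..k}" "B = majorana n \<mu>" by blast
    then show "supported_on n [1..<Suc q] B"
      unfolding mu(2) using k q by (intro supported_on_majorana) auto
  qed
  then have gen: "local_generator n l H'"
    using herm alg k l q by (intro local_generatorI[of _ _ "{1..k}" _ "[1..<Suc q]"]) auto
  note Fc = linear_gaussianD(2)[OF F] and gu = linear_gaussianD(1)[OF g(2)] and gc = linear_gaussianD(2)[OF g(2)]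
  have Wc: "W \<in> carrier_mat ?d ?d" unfolding WH using Hc by simp
  have "mat_exp (\<i> \<cdot>\<^sub>m H') = conj_by (F * g) W"
    unfolding H'_def WH using Hc unitary_matD(1)[OF U]
    by (simp add: conj_by_exp[OF U] conj_by_smult[of _ ?d])
  also have "\<dots> = conj_by g (conj_by F W)" using Fc gc Wc by (intro conj_by_comp)
  finally have "g * mat_exp (\<i> \<cdot>\<^sub>m H') * mat_adjoint g = conj_by F W"
    using conj_by_adjoint_inverse[OF gu, of "conj_by F W"] Fc Wc by simp
  moreover have "circuit n l (k * (2 * n) + 1 + k * (2 * n)) (g * mat_exp (\<i> \<cdot>\<^sub>m H') * mat_adjoint g)"
    by (intro circuit_mult circuit_adjoint g(1) circuit_gate gen)
  moreover have "k * (2 * n) + 1 + k * (2 * n) \<le> 4 * \<kappa> * n + 1"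
    using k(1) by simp
  ultimately show ?thesis using circuit_mono by metis
qed

text \<open>Each layer uses \<open>G * W * (F * L) = (G * F) * (conj_by F W * L)\<close>. The
  Gaussian factors merge into one, whose quadratic cost is therefore paid once, independently of
  t.\<close>

lemma doped_gaussian_factorization:
  assumes l: "\<kappa> + 2 \<le> l"
    and G: "\<forall>i\<in>{0..t}. gaussian_unitary n (G i)" and W: "\<forall>i\<in>{1..t}. majorana_local_gate n \<kappa> (W i)"
  shows "\<exists>F L. linear_gaussian n F \<and> circuit n l (t * (4 * \<kappa> * n + 1)) L \<and> alternating_product G W t = F * L"
  using G W
proof (induction t)
  case 0
  have "linear_gaussian n (G 0)" using 0 by (auto intro: gaussian_unitary_linear)
  then show ?case using linear_gaussianD(2)[of n "G 0"]
    by (intro exI[of _ "G 0"] exI[of _ "1\<^sub>m (2 ^ n)"]) auto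
next
  case (Suc t)
  let ?d = "2 ^ n :: nat"
  obtain F L where F: "linear_gaussian n F" and L: "circuit n l (t * (4 * \<kappa> * n + 1)) L"
    and eq: "alternating_product G W t = F * L"
    using Suc by auto
  have G': "linear_gaussian n (G (Suc t))" using Suc.prems by (auto intro: gaussian_unitary_linear)
  have W': "majorana_local_gate n \<kappa> (W (Suc t))" using Suc.prems by auto
  have Wc: "W (Suc t) \<in> carrier_mat ?d ?d"
    using W' unfolding majorana_local_gate_def hermitian_mat_def by auto
  note Fu = unitary_matD[OF linear_gaussianD(1)[OF F]] and Gc = linear_gaussianD(2)[OF G']
    and Lc = unitary_matD(1)[OF circuit_unitary[OF L]]
  have "G (Suc t) * F * (conj_by F (W (Suc t)) * L) = G (Suc t) * ((F * mat_adjoint F) * (W (Suc t) * (F * L)))"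
    using Fu(1,2) Gc Lc Wc unfolding conj_by_def by (simp add: assoc_mult_mat[of _ ?d ?d _ ?d _ ?d])
  also have "\<dots> = alternating_product G W (Suc t)"
    using Fu(1,4) Gc Lc Wc by (simp add: eq assoc_mult_mat[of _ ?d ?d _ ?d _ ?d])
  finally have "alternating_product G W (Suc t) = G (Suc t) * F * (conj_by F (W (Suc t)) * L)" ..
  moreover have "linear_gaussian n (G (Suc t) * F)" by (rule linear_gaussian_mult[OF G' F])
  moreover have "circuit n l (Suc t * (4 * \<kappa> * n + 1)) (conj_by F (W (Suc t)) * L)"
    using circuit_mult[OF conjugated_gate_circuit[OF l F W'] L] by (simp add: add_ac)
  ultimately show ?case by blast
qed

section \<open>Comparison of the gate count with the two claimed bounds\<close>

theorem proposition30:
  fixes \<kappa> :: nat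
  shows "\<exists>l C :: nat. \<forall>n t :: nat. \<forall>U :: complex mat.
    n \<ge> 1 \<longrightarrow> doped_gaussian_unitary n t \<kappa> U \<longrightarrow>
      qubit_circuit_complexity l n U
        \<le> enat (if \<kappa> * t \<le> n then C * (n ^ 2 + t ^ 3) else C * (n ^ 2 * t)) \<and>
      fermionic_circuit_complexity l n U
        \<le> enat (if \<kappa> * t \<le> n then C * (n ^ 2 + t ^ 3) else C * (n ^ 2 * t))"
proof (rule exI[of _ "\<kappa> + 2"], rule exI[of _ "4 * \<kappa> + 11"], intro allI impI)
  fix n t :: nat and U :: "complex mat"
  assume n: "n \<ge> 1" and U: "doped_gaussian_unitary n t \<kappa> U"
  \<comment> \<open>One constant for both regimes: the estimates below need 10 for the
    \<open>n ^ 2\<close> term and 1 for the \<open>t ^ 3\<close> term in the first, and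
    \<open>4 * \<kappa> + 7\<close> in the second.\<close>
  let ?C = "4 * \<kappa> + 11"
  let ?N = "4 * n ^ 2 + n + 1 + t * (4 * \<kappa> * n + 1)"
  obtain F L where F: "linear_gaussian n F" and L: "circuit n (\<kappa> + 2) (t * (4 * \<kappa> * n + 1)) L" and eq: "U = F * L"
    using U doped_gaussian_factorization[of \<kappa> "\<kappa> + 2"] unfolding doped_gaussian_unitary_def by blast
  have circ: "circuit n (\<kappa> + 2) ?N U"
    unfolding eq using circuit_mult[OF gaussian_circuit[OF _ n F] L] by simp
  have nn: "n \<le> n ^ 2" "1 \<le> n ^ 2" using n by (auto simp: power2_eq_square)
  have "?N \<le> (if \<kappa> * t \<le> n then ?C * (n ^ 2 + t ^ 3) else ?C * (n ^ 2 * t))"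
  proof (cases "\<kappa> * t \<le> n")
    case True
    \<comment> \<open>\<open>\<kappa> * t \<le> n\<close> absorbs the rotations of all conjugated
      gates into \<open>n ^ 2\<close>; the leftover t, one core gate per layer, goes into
      \<open>t ^ 3\<close>.\<close>
    have "t * (4 * \<kappa> * n + 1) = 4 * (\<kappa> * t) * n + t" by (simp add: algebra_simps)
    also have "\<dots> \<le> 4 * n ^ 2 + t ^ 3"
    proof (rule add_mono)
      show "4 * (\<kappa> * t) * n \<le> 4 * n ^ 2" using True by (simp add: power2_eq_square)
      show "t \<le> t ^ 3" by (cases "t = 0") (auto intro: self_le_power)
    qed
    finally have "?N \<le> 10 * n ^ 2 + t ^ 3" using nn by simp
    also have "\<dots> \<le> ?C * (n ^ 2 + t ^ 3)" by (simp add: algebra_simps)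
    finally show ?thesis using True by simp
  next
    case False
    \<comment> \<open>\<open>\<kappa> * t > n\<close> excludes t = 0, so \<open>n ^ 2 * t\<close>
      also dominates the cost of the Gaussian factor.\<close>
    then have t: "1 \<le> t" by (cases t) auto
    have "4 * n ^ 2 + n + 1 \<le> 6 * n ^ 2" using nn by simp
    also have "\<dots> \<le> 6 * (n ^ 2 * t)" using t by simp
    finally have "4 * n ^ 2 + n + 1 \<le> 6 * (n ^ 2 * t)" .
    moreover have "4 * \<kappa> * n + 1 \<le> 4 * \<kappa> * n ^ 2 + n ^ 2"
      by (intro add_mono mult_le_mono2 nn)
    then have "4 * \<kappa> * n + 1 \<le> (4 * \<kappa> + 1) * n ^ 2" by simp
    then have "t * (4 * \<kappa> * n + 1) \<le> (4 * \<kappa> + 1) * (n ^ 2 * t)"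
      by (metis mult.assoc mult.commute mult_le_mono2)
    ultimately have "?N \<le> (4 * \<kappa> + 7) * (n ^ 2 * t)" by (simp add: algebra_simps)
    also have "\<dots> \<le> ?C * (n ^ 2 * t)" by (intro mult_le_mono1) simp
    finally show ?thesis using False by simp
  qed
  then show "qubit_circuit_complexity (\<kappa> + 2) n U
        \<le> enat (if \<kappa> * t \<le> n then ?C * (n ^ 2 + t ^ 3) else ?C * (n ^ 2 * t)) \<and>
      fermionic_circuit_complexity (\<kappa> + 2) n U
        \<le> enat (if \<kappa> * t \<le> n then ?C * (n ^ 2 + t ^ 3) else ?C * (n ^ 2 * t))"
    using circuit_complexity_le[OF circuit_mono[OF circ]] by blast
qed

end
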